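(* For all odd $k\geq 3$ and any $n\geq 2k+4$, as well as for $k=2$ and any $n\geq 9$, there exists a neighborly simplicial $(2k+1)$-polytope with $n$ vertices all of whose missing faces have dimension $k$.
   Context: A $d$-polytope is a $d$-dimensional convex hull of finitely many points in a Euclidean space; it is simplicial if all its proper faces are simplices. The boundary complex $\partial P$ of a simplicial polytope $P$ is the simplicial complex consisting of the vertex sets of the proper faces of $P$ (including the empty set). A missing face of $P$ is a set of vertices of $P$ that is not a face of $\partial P$ but all of whose proper subsets are faces of $\partial P$; the dimension of a missing face is its size minus one. A simplicial $d$-polytope is neighborly if it is $\lfloor d/2\rfloor$-neighborly, i.e., every set of $\lfloor d/2\rfloor$ of its vertices is the vertex set of a face; so a $(2k+1)$-polytope is neighborly if it is $k$-neighborly. *)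

theory Defs
  imports "HOL-Analysis.Analysis"
begin

definition d_polytope :: "nat \<Rightarrow> 'a::euclidean_space set \<Rightarrow> bool" where
  "d_polytope d P \<longleftrightarrow> polytope P \<and> aff_dim P = int d"

definition vertices :: "'a::euclidean_space set \<Rightarrow> 'a set" where
  "vertices P = {v. v extreme_point_of P}"

text \<open>The library relation \<open>face_of\<close> counts both the empty set and \<open>P\<close> itself as faces
  of \<open>P\<close>.  The parameter of \<open>simplex\<close> is an integer, and the empty set is the simplex
  of dimension \<open>-1\<close>.\<close>

definition simplicial_polytope :: "'a::euclidean_space set \<Rightarrow> bool" where
  "simplicial_polytope P \<longleftrightarrow>
     polytope P \<and> (\<forall>F. F face_of P \<and> F \<noteq> P \<longrightarrow> (\<exists>m. m simplex F))"

definition boundary_complex :: "'a::euclidean_space set \<Rightarrow> 'a set set" where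
  "boundary_complex P = {vertices F | F. F face_of P \<and> F \<noteq> P}"

definition missing_face :: "'a::euclidean_space set \<Rightarrow> 'a set \<Rightarrow> bool" where
  "missing_face P M \<longleftrightarrow>
     M \<subseteq> vertices P \<and> M \<notin> boundary_complex P \<and> (\<forall>T. T \<subset> M \<longrightarrow> T \<in> boundary_complex P)"

text \<open>Integer-valued, so that the empty set has dimension \<open>-1\<close>.\<close>

definition face_dim :: "'a set \<Rightarrow> int" where
  "face_dim M = int (card M) - 1"

definition k_neighborly :: "nat \<Rightarrow> 'a::euclidean_space set \<Rightarrow> bool" where
  "k_neighborly k P \<longleftrightarrow>
     (\<forall>S. S \<subseteq> vertices P \<and> card S = k \<and> finite S \<longrightarrow> (\<exists>F. F face_of P \<and> vertices F = S))"

definition neighborly :: "'a::euclidean_space set \<Rightarrow> bool" where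
  "neighborly P \<longleftrightarrow> k_neighborly (nat (aff_dim P) div 2) P"

end

theory Submission imports Defs begin

text \<open>
  The vertices lie on the curve
  \<open>t \<mapsto> (cos t, sin t, \<dots>, cos (k t), sin (k t), cos ((k + 1) t - \<omega>))\<close>. Affine functionals restrict to
  trigonometric polynomials of degree \<open>k + 1\<close> with one prescribed phase in the top degree, and
  \<open>\<Prod> sin ((t - r\<^sub>i) / 2)\<close> with \<open>2 k + 2\<close> factors is of this kind exactly when the sum of its zeros
  is \<open>2 \<omega>\<close> modulo \<open>2 \<pi>\<close>. A supporting function of a face that contains \<open>k + 1\<close> pairwise
  nonadjacent vertices needs a further zero between the two neighbours of each of them, so such
  vertices span a face iff \<open>2 \<omega>\<close> modulo \<open>2 \<pi>\<close> lies between the sum over the vertices and their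
  predecessors and the sum over the vertices and their successors.

  Let \<open>M\<close> be a missing face with at least \<open>k + 2\<close> elements; all its \<open>(k + 1)\<close>-subsets are faces.
  If \<open>M\<close> contains no \<open>k + 2\<close> pairwise nonadjacent vertices, then the greedy selections from the left
  and from the right are joined by moves to adjacent vertices, the conditions for all intermediate
  sets refer to the same representative of \<open>2 \<omega>\<close> modulo \<open>2 \<pi>\<close>, and sliding the zeros gives a
  supporting function for all of \<open>M\<close>, a contradiction. It remains to choose the points such
  that no \<open>k + 2\<close> pairwise nonadjacent vertices have only faces as \<open>(k + 1)\<close>-subsets. For odd \<open>k\<close>
  equally spaced points work: modulo the number of points, the sums that give faces form two
  intervals, and each of them arises from the omission of at most \<open>(k + 1) / 2\<close> of the \<open>k + 2\<close>
  vertices. For \<open>k = 2\<close> nine equally spaced points work, also after one of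
  them is replaced by a cluster.
\<close>


section \<open>Trigonometric polynomials\<close>

definition trig_poly :: "nat \<Rightarrow> (real \<Rightarrow> real) \<Rightarrow> bool" where
  "trig_poly m q \<longleftrightarrow>
     (\<exists>a b. \<forall>t. q t = (\<Sum>j\<le>m. a j * cos (real j * t) + b j * sin (real j * t)))"

lemma trig_poly_add:
  assumes "trig_poly m p" "trig_poly m q"
  shows "trig_poly m (\<lambda>t. p t + q t)"
proof -
  obtain a b a' b' where "\<forall>t. p t = (\<Sum>j\<le>m. a j * cos (real j * t) + b j * sin (real j * t))"
    "\<forall>t. q t = (\<Sum>j\<le>m. a' j * cos (real j * t) + b' j * sin (real j * t))"
    using assms unfolding trig_poly_def by blast
  then show ?thesis
    unfolding trig_poly_def
    by (intro exI[of _ "\<lambda>j. a j + a' j"] exI[of _ "\<lambda>j. b j + b' j"])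
       (simp add: sum.distrib[symmetric] algebra_simps)
qed

lemma trig_poly_cmult:
  assumes "trig_poly m p"
  shows "trig_poly m (\<lambda>t. r * p t)"
proof -
  obtain a b where "\<forall>t. p t = (\<Sum>j\<le>m. a j * cos (real j * t) + b j * sin (real j * t))"
    using assms unfolding trig_poly_def by blast
  then show ?thesis
    unfolding trig_poly_def
    by (intro exI[of _ "\<lambda>j. r * a j"] exI[of _ "\<lambda>j. r * b j"])
       (simp add: sum_distrib_left algebra_simps)
qed

lemma trig_poly_cos_shift:
  assumes "j \<le> m"
  shows "trig_poly m (\<lambda>t. cos (real j * t - u))"
  unfolding trig_poly_def
proof (intro exI allI)
  fix t
  have "(\<Sum>i\<le>m. (if i = j then cos u else 0) * cos (real i * t)
               + (if i = j then sin u else 0) * sin (real i * t))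
      = (\<Sum>i\<le>m. if i = j then cos u * cos (real j * t) + sin u * sin (real j * t) else 0)"
    by (intro sum.cong) auto
  also have "\<dots> = cos (real j * t - u)"
    using assms by (simp add: cos_diff algebra_simps)
  finally show "cos (real j * t - u) = (\<Sum>i\<le>m. (if i = j then cos u else 0) * cos (real i * t)
               + (if i = j then sin u else 0) * sin (real i * t))" by simp
qed

lemma trig_poly_const: "trig_poly m (\<lambda>t. r)"
  using trig_poly_cmult[OF trig_poly_cos_shift[of 0 m 0], of r] by simp

lemma trig_poly_sin_cos:
  assumes "j \<le> m"
  shows "trig_poly m (\<lambda>t. a * cos (real j * t) + b * sin (real j * t))"
  using trig_poly_add[OF trig_poly_cmult[OF trig_poly_cos_shift[OF assms, of 0], of a]
      trig_poly_cmult[OF trig_poly_cos_shift[OF assms, of "pi/2"], of b]]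
  by (simp add: cos_diff)

lemma trig_poly_sum:
  assumes "finite I" "\<And>i. i \<in> I \<Longrightarrow> trig_poly m (p i)"
  shows "trig_poly m (\<lambda>t. \<Sum>i\<in>I. p i t)"
  using assms by (induction rule: finite_induct) (auto intro: trig_poly_add trig_poly_const)

lemma trig_poly_mono:
  assumes "trig_poly m p" "m \<le> m'"
  shows "trig_poly m' p"
proof -
  obtain a b where *: "\<And>t. p t = (\<Sum>j\<le>m. a j * cos (real j * t) + b j * sin (real j * t))"
    using assms unfolding trig_poly_def by blast
  have "trig_poly m' (\<lambda>t. \<Sum>j\<le>m. a j * cos (real j * t) + b j * sin (real j * t))"
    using assms(2) by (intro trig_poly_sum trig_poly_sin_cos) auto
  also have "(\<lambda>t. \<Sum>j\<le>m. a j * cos (real j * t) + b j * sin (real j * t)) = p"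
    using * by (simp add: fun_eq_iff)
  finally show ?thesis .
qed

lemma trig_poly_cos_times_cos:
  assumes "j \<le> m"
  shows "trig_poly (Suc m) (\<lambda>t. cos (real j * t - u) * cos (t - v))"
proof -
  have up: "trig_poly (Suc m) (\<lambda>t. cos (real (Suc j) * t - (u + v)))"
    using assms by (intro trig_poly_cos_shift) auto
  have down: "trig_poly (Suc m) (\<lambda>t. cos (real j * t - u - (t - v)))"
  proof (cases j)
    \<comment> \<open>For \<open>j = 0\<close> the difference frequency is -1; evenness of cosine
      turns it into frequency 1, which \<open>Suc m\<close> always admits.\<close>
    case 0
    have "trig_poly (Suc m) (\<lambda>t. cos (real 1 * t - (v - u)))"
      by (rule trig_poly_cos_shift) simp
    also have "(\<lambda>t. cos (real 1 * t - (v - u))) = (\<lambda>t. cos (real j * t - u - (t - v)))"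
    proof
      fix t
      have "real j * t - u - (t - v) = - (real 1 * t - (v - u))" using 0 by simp
      then show "cos (real 1 * t - (v - u)) = cos (real j * t - u - (t - v))"
        by (simp only: cos_minus)
    qed
    finally show ?thesis .
  next
    case (Suc i)
    have "trig_poly (Suc m) (\<lambda>t. cos (real i * t - (u - v)))"
      using assms Suc by (intro trig_poly_cos_shift) auto
    also have "(\<lambda>t. cos (real i * t - (u - v))) = (\<lambda>t. cos (real j * t - u - (t - v)))"
      using Suc by (simp add: algebra_simps)
    finally show ?thesis .
  qed
  have "(\<lambda>t. cos (real j * t - u) * cos (t - v))
      = (\<lambda>t. 1/2 * cos (real j * t - u - (t - v)) + 1/2 * cos (real (Suc j) * t - (u + v)))"
  proof
    fix t
    have "real (Suc j) * t - (u + v) = (real j * t - u) + (t - v)" by (simp add: algebra_simps)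
    then show "cos (real j * t - u) * cos (t - v)
        = 1/2 * cos (real j * t - u - (t - v)) + 1/2 * cos (real (Suc j) * t - (u + v))"
      by (simp only: cos_times_cos add_divide_distrib)
  qed
  then show ?thesis
    using trig_poly_add[OF trig_poly_cmult[OF down, of "1/2"] trig_poly_cmult[OF up, of "1/2"]]
    by simp
qed

lemma trig_poly_times_cos:
  assumes "trig_poly m q"
  shows "trig_poly (Suc m) (\<lambda>t. q t * cos (t - v))"
proof -
  obtain a b where *: "\<And>t. q t = (\<Sum>j\<le>m. a j * cos (real j * t) + b j * sin (real j * t))"
    using assms unfolding trig_poly_def by blast
  have "trig_poly (Suc m) (\<lambda>t. \<Sum>j\<le>m. a j * (cos (real j * t - 0) * cos (t - v))
          + b j * (cos (real j * t - pi/2) * cos (t - v)))"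
    by (intro trig_poly_sum trig_poly_add trig_poly_cmult trig_poly_cos_times_cos) auto
  also have "(\<lambda>t. \<Sum>j\<le>m. a j * (cos (real j * t - 0) * cos (t - v))
          + b j * (cos (real j * t - pi/2) * cos (t - v))) = (\<lambda>t. q t * cos (t - v))"
  proof
    fix t
    have "cos (real j * t - pi/2) = sin (real j * t)" for j by (simp add: cos_diff)
    then show "(\<Sum>j\<le>m. a j * (cos (real j * t - 0) * cos (t - v))
          + b j * (cos (real j * t - pi/2) * cos (t - v))) = q t * cos (t - v)"
      by (simp add: * sum_distrib_right distrib_right mult.assoc)
  qed
  finally show ?thesis .
qed

text \<open>Only one combination of the two top-frequency functions is allowed. This leaves
  \<open>2 * k + 2\<close> dimensions, as many as affine functionals on a space of dimension
  \<open>2 * k + 1\<close> have.\<close>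

definition trig_form :: "nat \<Rightarrow> real \<Rightarrow> (real \<Rightarrow> real) \<Rightarrow> bool" where
  "trig_form k \<omega> p \<longleftrightarrow>
     (\<exists>q \<beta>. trig_poly k q \<and> p = (\<lambda>t. q t + \<beta> * cos (real (Suc k) * t - \<omega>)))"

lemma trig_formI:
  "trig_poly k q \<Longrightarrow> p = (\<lambda>t. q t + \<beta> * cos (real (Suc k) * t - \<omega>)) \<Longrightarrow> trig_form k \<omega> p"
  unfolding trig_form_def by metis

lemma trig_formE:
  assumes "trig_form k \<omega> p"
  obtains q \<beta> where "trig_poly k q" "\<And>t. p t = q t + \<beta> * cos (real (Suc k) * t - \<omega>)"
  using assms unfolding trig_form_def by (auto simp only:)

lemma sin_times_sin_half:
  "sin ((t - u) / 2) * sin ((t - v) / 2) = cos ((u - v) / 2) / 2 - cos (t - (u + v) / 2) / (2::real)"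
proof -
  have "sin ((t - u) / 2) * sin ((t - v) / 2)
      = (cos ((t - u) / 2 - (t - v) / 2) - cos ((t - u) / 2 + (t - v) / 2)) / 2"
    by (rule sin_times_sin)
  moreover have "cos ((t - u) / 2 - (t - v) / 2) = cos ((u - v) / 2)"
  proof -
    have "(t - u) / 2 - (t - v) / 2 = - ((u - v) / 2)" by (simp add: field_simps)
    then show ?thesis by (simp only: cos_minus)
  qed
  moreover have "(t - u) / 2 + (t - v) / 2 = t - (u + v) / 2" by (simp add: field_simps)
  ultimately show ?thesis by (simp add: diff_divide_distrib)
qed

text \<open>Induction adds two zeros at a time. By the product-to-sum formula the phases add up in
  the top frequency, so the top phase is half the sum of all zeros.\<close>

lemma prod_sin_trig_form:
  "trig_form k ((\<Sum>i<2 * Suc k. \<rho> i) / 2) (\<lambda>t. \<Prod>i<2 * Suc k. sin ((t - \<rho> i) / 2))"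
proof (induction k)
  case 0
  have "{..<2 * Suc 0} = {0, 1::nat}" by auto
  then have eq: "(\<lambda>t. \<Prod>i<2 * Suc 0. sin ((t - \<rho> i) / 2))
      = (\<lambda>t. cos ((\<rho> 0 - \<rho> 1) / 2) / 2
             + (-1/2) * cos (real (Suc 0) * t - (\<Sum>i<2 * Suc 0. \<rho> i) / 2))"
    by (simp add: sin_times_sin_half)
  show ?case
    by (rule trig_formI[OF trig_poly_const eq])
next
  case (Suc k)
  define s where "s = (\<Sum>i<2 * Suc k. \<rho> i) / 2"
  define u v where "u = \<rho> (2 * Suc k)" and "v = \<rho> (Suc (2 * Suc k))"
  define d e where "d = cos ((u - v) / 2) / 2" and "e = (u + v) / 2"
  from Suc obtain q C where q: "trig_poly k q" and
    eq: "\<And>t. (\<Prod>i<2 * Suc k. sin ((t - \<rho> i) / 2)) = q t + C * cos (real (Suc k) * t - s)"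
    unfolding s_def by (elim trig_formE) blast
  have ss: "2 * Suc (Suc k) = Suc (Suc (2 * Suc k))" by simp
  have prod: "(\<Prod>i<2 * Suc (Suc k). sin ((t - \<rho> i) / 2))
      = (q t + C * cos (real (Suc k) * t - s)) * (d - cos (t - e) / 2)" for t
    unfolding ss prod.lessThan_Suc eq mult.assoc u_def[symmetric] v_def[symmetric]
      sin_times_sin_half d_def e_def ..
  have sum: "(\<Sum>i<2 * Suc (Suc k). \<rho> i) / 2 = s + e"
    unfolding ss sum.lessThan_Suc s_def e_def u_def v_def by (simp only: add_divide_distrib add.assoc)
  \<comment> \<open>Everything of frequency at most \<open>k + 1\<close> is gathered here, including
    the difference term of frequency \<open>k\<close>; only frequency \<open>k + 2\<close> is left
    over.\<close>
  let ?r = "\<lambda>t. d * q t + (-1/2) * (q t * cos (t - e)) + (d * C) * cos (real (Suc k) * t - s)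
              + (- C / 4) * cos (real k * t - (s - e))"
  have r: "trig_poly (Suc k) ?r"
    using q trig_poly_mono[OF q, of "Suc k"]
    by (intro trig_poly_add trig_poly_cmult trig_poly_times_cos trig_poly_cos_shift) simp_all
  have "(\<Prod>i<2 * Suc (Suc k). sin ((t - \<rho> i) / 2))
      = ?r t + (- C / 4) * cos (real (Suc (Suc k)) * t - (s + e))" for t
  proof -
    have "cos (real (Suc k) * t - s) * cos (t - e)
       = (cos (real k * t - (s - e)) + cos (real (Suc (Suc k)) * t - (s + e))) / 2"
    proof -
      have "real (Suc k) * t - s - (t - e) = real k * t - (s - e)"
        "real (Suc k) * t - s + (t - e) = real (Suc (Suc k)) * t - (s + e)"
        by (simp_all add: algebra_simps)
      then show ?thesis by (simp only: cos_times_cos)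
    qed
    then have "(- 1 / 2) * C * (cos (real (Suc k) * t - s) * cos (t - e)) = (- C / 4) *
         (cos (real k * t - (s - e)) + cos (real (Suc (Suc k)) * t - (s + e)))"
      by (simp only:)
    then show ?thesis unfolding prod by (simp only: algebra_simps)
  qed
  then have "(\<lambda>t. \<Prod>i<2 * Suc (Suc k). sin ((t - \<rho> i) / 2))
      = (\<lambda>t. ?r t + (- C / 4) * cos (real (Suc (Suc k)) * t - (s + e)))" by (rule ext)
  from trig_formI[OF r this] show ?case unfolding sum .
qed

text \<open>Shifting the phase by a multiple of pi changes at most the sign of
  \<open>\<beta>\<close>, so the sum of the zeros matters only modulo 2 pi.\<close>

lemma trig_form_shift:
  assumes "trig_form k \<omega> p" "\<omega> = \<omega>' + pi * of_int z"
  shows "trig_form k \<omega>' p"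
proof -
  obtain q \<beta> where q: "trig_poly k q" and
    p: "\<And>t. p t = q t + \<beta> * cos (real (Suc k) * t - \<omega>)"
    using assms(1) by (elim trig_formE) blast
  have "cos (s - \<omega>) = cos (pi * of_int z) * cos (s - \<omega>')" for s
  proof -
    have "s - \<omega> = (s - \<omega>') - pi * of_int z" using assms(2) by simp
    moreover have "sin (pi * of_int z) = 0" by (simp add: sin_zero_iff_int2 mult.commute)
    ultimately show ?thesis by (simp only: cos_diff) simp
  qed
  then have "p = (\<lambda>t. q t + (\<beta> * cos (pi * of_int z)) * cos (real (Suc k) * t - \<omega>'))"
    by (intro ext) (simp only: p mult.assoc)
  with q show ?thesis by (rule trig_formI)
qed

section \<open>Divided differences of trigonometric polynomials\<close>

text \<open>The Lagrange interpolant of the monomial of degree \<open>e\<close> at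
  \<open>card I\<close> nodes is the monomial itself; the sum is its coefficient in degree
  \<open>card I - 1\<close>.\<close>

lemma lagrange_power_sum:
  fixes z :: "'i \<Rightarrow> complex"
  assumes "finite I" "inj_on z I" "e < card I"
  shows "(\<Sum>i\<in>I. z i ^ e / (\<Prod>j\<in>I-{i}. z i - z j)) = (if Suc e = card I then 1 else 0)"
proof -
  define D where "D i = (\<Prod>j\<in>I-{i}. z i - z j)" for i
  define P where "P i = (\<Prod>j\<in>I-{i}. [:- z j, 1:])" for i
  define Q where "Q = (\<Sum>i\<in>I. smult (z i ^ e / D i) (P i))"
  have D: "D i \<noteq> 0" if "i \<in> I" for i
    using assms that by (auto simp: D_def inj_on_def)
  have deg: "degree (P i) = card I - 1" and lead: "coeff (P i) (card I - 1) = 1" if "i \<in> I" for i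
  proof -
    have "degree (P i) = (\<Sum>j\<in>I-{i}. degree [:- z j, 1:])"
      unfolding P_def by (rule degree_prod_eq_sum_degree) auto
    then show d: "degree (P i) = card I - 1" using assms(1) that by simp
    have "lead_coeff (P i) = 1" unfolding P_def lead_coeff_prod by simp
    then show "coeff (P i) (card I - 1) = 1" using d by simp
  qed
  have "poly (Q - monom 1 e) (z i) = 0" if "i \<in> I" for i
  proof -
    have P: "poly (P l) (z i) = (if l = i then D i else 0)" if "l \<in> I" for l
      using assms(1) \<open>i \<in> I\<close> that by (auto simp: P_def D_def poly_prod intro!: prod.cong)
    have "poly Q (z i) = (\<Sum>l\<in>I. if l = i then z i ^ e else 0)"
      unfolding Q_def poly_sum by (intro sum.cong) (use D P in auto)
    then show ?thesis using that assms(1) by (simp add: poly_monom)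
  qed
  moreover have "degree (Q - monom 1 e) < card (z ` I)"
  proof -
    have "degree Q \<le> card I - 1" unfolding Q_def
      by (intro degree_sum_le assms) (use deg in \<open>auto intro: order.trans[OF degree_smult_le]\<close>)
    moreover have "degree (monom (1::complex) e) \<le> card I - 1"
      using assms(3) by (simp add: degree_monom_eq)
    ultimately have "degree (Q - monom 1 e) \<le> card I - 1" by (rule degree_diff_le)
    then show ?thesis using assms by (simp add: card_image)
  qed
  ultimately have "Q - monom 1 e = 0"
    by (intro poly_eqI_degree[of "z ` I"]) auto
  then have "coeff Q (card I - 1) = (if e = card I - 1 then 1 else 0)" by simp
  moreover have "coeff Q (card I - 1) = (\<Sum>i\<in>I. z i ^ e / D i)"
    unfolding Q_def coeff_sum by (intro sum.cong) (use lead in auto)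
  moreover have "e = card I - 1 \<longleftrightarrow> Suc e = card I" using assms(3) by linarith
  ultimately show ?thesis unfolding D_def by simp
qed

lemma cis_diff_half: "cis a - cis b = 2 * \<i> * of_real (sin ((a - b) / 2)) * (cis (a/2) * cis (b/2))"
proof -
  have 1: "cis a = cis ((a+b)/2) * cis ((a-b)/2)" and 2: "cis b = cis ((a+b)/2) * cis (-((a-b)/2))"
    by (simp_all add: cis_mult field_simps)
  have "cis (a/2) * cis (b/2) = cis ((a+b)/2)" by (simp add: cis_mult add_divide_distrib)
  moreover have "cis ((a-b)/2) - cis (-((a-b)/2)) = 2 * \<i> * of_real (sin ((a-b)/2))"
    by (simp add: complex_eq_iff)
  ultimately show ?thesis unfolding 1 2 by (simp add: algebra_simps)
qed

text \<open>With nodes \<open>cis (\<theta> i)\<close> the sine products are Lagrange denominators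
  up to a constant and \<open>z i ^ k\<close>. Frequency \<open>e\<close> thus becomes exponent
  \<open>k + e\<close>, which reaches the critical degree \<open>2 * k + 1\<close> only for
  \<open>e = Suc k\<close>.\<close>

lemma cis_divided_difference:
  fixes \<theta> :: "'i \<Rightarrow> real"
  assumes "finite I" "card I = 2 * Suc k" "e \<le> Suc k"
    and "\<And>i j. i \<in> I \<Longrightarrow> j \<in> I \<Longrightarrow> i \<noteq> j \<Longrightarrow> sin ((\<theta> i - \<theta> j) / 2) \<noteq> 0"
  shows "(\<Sum>i\<in>I. of_real (1 / (\<Prod>j\<in>I-{i}. sin ((\<theta> i - \<theta> j) / 2))) * cis (real e * \<theta> i))
       = (if e = Suc k then 2 * \<i> * (-4) ^ k * cis ((\<Sum>i\<in>I. \<theta> i) / 2) else 0)"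
proof -
  define z where "z i = cis (\<theta> i)" for i
  define W where "W = (\<Prod>i\<in>I. cis (\<theta> i / 2))"
  have W: "W = cis ((\<Sum>i\<in>I. \<theta> i) / 2)"
    unfolding W_def using assms(1)
    by (induction I rule: finite_induct) (auto simp: cis_mult add_divide_distrib)
  have inj: "inj_on z I"
  proof
    fix i j assume "i \<in> I" "j \<in> I" "z i = z j"
    then have "cis (\<theta> i) - cis (\<theta> j) = 0" by (simp add: z_def)
    then have "sin ((\<theta> i - \<theta> j) / 2) = 0" unfolding cis_diff_half by simp
    then show "i = j" using assms(4) \<open>i \<in> I\<close> \<open>j \<in> I\<close> by blast
  qed
  have ipow: "(2 * \<i>) ^ (2 * k + 1) = 2 * \<i> * (-4) ^ k"
    by (simp add: power_mult power_mult_distrib)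
  have summand: "of_real (1 / (\<Prod>j\<in>I-{i}. sin ((\<theta> i - \<theta> j) / 2))) * cis (real e * \<theta> i)
      = (2 * \<i> * (-4) ^ k * W) * (z i ^ (k + e) / (\<Prod>j\<in>I-{i}. z i - z j))" if i: "i \<in> I" for i
  proof -
    define s where "s = (\<Prod>j\<in>I-{i}. sin ((\<theta> i - \<theta> j) / 2))"
    have s: "s \<noteq> 0" using assms i by (auto simp: s_def)
    have card: "card (I - {i}) = 2 * k + 1" using assms i by simp
    have "W = cis (\<theta> i / 2) * (\<Prod>j\<in>I-{i}. cis (\<theta> j / 2))"
      unfolding W_def using assms(1) i by (rule prod.remove)
    moreover have "(\<Prod>j\<in>I-{i}. z i - z j)
       = (2 * \<i>) ^ (2 * k + 1) * of_real s * (cis (\<theta> i / 2) ^ (2 * k + 1) * (\<Prod>j\<in>I-{i}. cis (\<theta> j / 2)))"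
      unfolding z_def cis_diff_half prod.distrib s_def prod_constant card of_real_prod power_mult_distrib ..
    moreover have "z i = cis (\<theta> i / 2) ^ 2" by (simp add: z_def power2_eq_square cis_mult)
    \<comment> \<open>The odd power supplies one half-angle factor, which completes the product over
      the other indices to \<open>W\<close>.\<close>
    then have "cis (\<theta> i / 2) ^ (2 * k + 1) = z i ^ k * cis (\<theta> i / 2)"
      by (simp add: power_mult)
    ultimately have "(\<Prod>j\<in>I-{i}. z i - z j) = (2 * \<i> * (-4) ^ k) * of_real s * z i ^ k * W"
      unfolding ipow by simp
    moreover have "cis (real e * \<theta> i) = z i ^ e" by (simp only: z_def Complex.DeMoivre)
    moreover have "z i \<noteq> 0" "W \<noteq> 0" unfolding z_def W by simp_all
    ultimately show ?thesis using s unfolding s_def[symmetric]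
      by (simp add: power_add field_simps)
  qed
  have "k + e < card I" using assms by simp
  then have "(\<Sum>i\<in>I. (2 * \<i> * (-4) ^ k * W) * (z i ^ (k + e) / (\<Prod>j\<in>I-{i}. z i - z j)))
     = (2 * \<i> * (-4) ^ k * W) * (if Suc (k + e) = card I then 1 else 0)"
    unfolding sum_distrib_left[symmetric] using lagrange_power_sum[OF assms(1) inj] by simp
  also have "\<dots> = (if e = Suc k then 2 * \<i> * (-4) ^ k * cis ((\<Sum>i\<in>I. \<theta> i) / 2) else 0)"
    using assms(2) by (auto simp: W)
  finally show ?thesis using summand by (simp cong: sum.cong)
qed

text \<open>The weighted sum kills all frequencies up to \<open>k\<close> and sees only
  \<open>\<beta>\<close>; its sign depends on how half the sum of the nodes lies relative to
  \<open>\<omega>\<close>.\<close>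

lemma trig_poly_divided_difference:
  fixes \<theta> :: "'i \<Rightarrow> real"
  assumes I: "finite I" "card I = 2 * Suc k"
    and dist: "\<And>i j. i \<in> I \<Longrightarrow> j \<in> I \<Longrightarrow> i \<noteq> j \<Longrightarrow> sin ((\<theta> i - \<theta> j) / 2) \<noteq> 0"
    and q: "trig_poly k q"
    and p: "\<And>t. p t = q t + \<beta> * cos (real (Suc k) * t - \<omega>)"
  shows "(\<Sum>i\<in>I. p (\<theta> i) / (\<Prod>j\<in>I-{i}. sin ((\<theta> i - \<theta> j) / 2)))
       = - 2 * (-4) ^ k * \<beta> * sin ((\<Sum>i\<in>I. \<theta> i) / 2 - \<omega>)"
proof -
  define l where "l i = 1 / (\<Prod>j\<in>I-{i}. sin ((\<theta> i - \<theta> j) / 2))" for i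
  have dd: "(\<Sum>i\<in>I. of_real (l i) * cis (real e * \<theta> i))
      = (if e = Suc k then 2 * \<i> * (-4) ^ k * cis ((\<Sum>i\<in>I. \<theta> i) / 2) else 0)"
    if "e \<le> Suc k" for e
    unfolding l_def by (rule cis_divided_difference[OF I that dist])
  have low: "(\<Sum>i\<in>I. l i * q (\<theta> i)) = 0"
  proof -
    have cs: "(\<Sum>i\<in>I. l i * cos (real j * \<theta> i)) = 0 \<and> (\<Sum>i\<in>I. l i * sin (real j * \<theta> i)) = 0"
      if "j \<le> k" for j
      using dd[of j] that by (simp add: complex_eq_iff)
    obtain a b where ab: "\<And>t. q t = (\<Sum>j\<le>k. a j * cos (real j * t) + b j * sin (real j * t))"
      using q unfolding trig_poly_def by blast
    have "(\<Sum>i\<in>I. l i * q (\<theta> i))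
        = (\<Sum>j\<le>k. \<Sum>i\<in>I. l i * (a j * cos (real j * \<theta> i) + b j * sin (real j * \<theta> i)))"
      unfolding ab sum_distrib_left by (rule sum.swap)
    also have "\<dots> = (\<Sum>j\<le>k. a j * (\<Sum>i\<in>I. l i * cos (real j * \<theta> i))
                         + b j * (\<Sum>i\<in>I. l i * sin (real j * \<theta> i)))"
      by (simp add: sum_distrib_left sum.distrib algebra_simps)
    finally show ?thesis using cs by simp
  qed
  have "(\<Sum>i\<in>I. of_real (l i) * cis (real (Suc k) * \<theta> i - \<omega>))
      = cis (- \<omega>) * (\<Sum>i\<in>I. of_real (l i) * cis (real (Suc k) * \<theta> i))"
    unfolding sum_distrib_left
    by (intro sum.cong refl) (simp only: diff_conv_add_uminus cis_mult[symmetric] mult_ac)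
  also have "\<dots> = cis (- \<omega>) * (2 * \<i> * (-4) ^ k * cis ((\<Sum>i\<in>I. \<theta> i) / 2))"
    using dd[of "Suc k"] by simp
  also have "\<dots> = of_real (2 * (-4) ^ k) * (\<i> * cis ((\<Sum>i\<in>I. \<theta> i) / 2 - \<omega>))"
    by (simp only: diff_conv_add_uminus cis_mult[symmetric]) (simp add: mult_ac)
  finally have "Re (\<Sum>i\<in>I. of_real (l i) * cis (real (Suc k) * \<theta> i - \<omega>))
     = Re (of_real (2 * (-4) ^ k) * (\<i> * cis ((\<Sum>i\<in>I. \<theta> i) / 2 - \<omega>)))" by (rule arg_cong)
  then have top: "(\<Sum>i\<in>I. l i * cos (real (Suc k) * \<theta> i - \<omega>))
      = - 2 * (-4) ^ k * sin ((\<Sum>i\<in>I. \<theta> i) / 2 - \<omega>)"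
    by (simp only: Re_sum Re_complex_of_real Im_complex_of_real times_complex.simps cis.simps) simp
  have "(\<Sum>i\<in>I. p (\<theta> i) / (\<Prod>j\<in>I-{i}. sin ((\<theta> i - \<theta> j) / 2)))
      = (\<Sum>i\<in>I. l i * q (\<theta> i)) + \<beta> * (\<Sum>i\<in>I. l i * cos (real (Suc k) * \<theta> i - \<omega>))"
    unfolding sum_distrib_left sum.distrib[symmetric]
    by (intro sum.cong refl) (simp only: p l_def, simp add: add_divide_distrib)
  then show ?thesis unfolding low top by simp
qed

section \<open>Points on a trigonometric moment curve\<close>

lemma sum_odd_even_split:
  "(\<Sum>i<2 * k + 1. g i) = g 0 + (\<Sum>j<k. g (2 * j + 1) + g (2 * j + 2))"
  for g :: "nat \<Rightarrow> 'b::comm_monoid_add"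
proof (induction k)
  case (Suc k)
  have "2 * Suc k + 1 = Suc (Suc (2 * k + 1))" by simp
  then show ?case by (simp only: sum.lessThan_Suc Suc) (simp add: add.assoc)
qed simp

lemma trig_form_periodic:
  assumes "trig_form k \<omega> p"
  shows "p (t + 2 * pi) = p t"
proof -
  obtain q \<beta> where q: "trig_poly k q" and p: "\<And>t. p t = q t + \<beta> * cos (real (Suc k) * t - \<omega>)"
    using assms by (elim trig_formE) blast
  obtain a b where q': "\<And>t. q t = (\<Sum>j\<le>k. a j * cos (real j * t) + b j * sin (real j * t))"
    using q unfolding trig_poly_def by blast
  have c: "cos (real j * (t + 2 * pi) - u) = cos (real j * t - u)" for j u
  proof -
    have "real j * (t + 2 * pi) - u = (real j * t - u) + 2 * real j * pi"
      by (simp add: algebra_simps)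
    moreover have "sin (2 * real j * pi) = 0" "cos (2 * real j * pi) = 1"
      using sin_2npi[of j] cos_2npi[of j] by simp_all
    ultimately show ?thesis by (simp only: cos_add)
  qed
  have s: "sin (real j * (t + 2 * pi)) = sin (real j * t)" for j
    using c[of j "pi/2"] by (simp add: cos_diff)
  show ?thesis unfolding p q' c s using c[of _ 0] by simp
qed

text \<open>The coordinates of the curve span the trigonometric forms modulo constants, and
  constants are supplied by the offset \<open>d\<close>.\<close>

lemma trig_form_embedding:
  assumes "DIM('a::euclidean_space) = 2 * k + 1"
  obtains \<phi> :: "real \<Rightarrow> 'a::euclidean_space" where
    "\<And>p. trig_form k \<omega> p \<longleftrightarrow> (\<exists>a d. \<forall>t. p t = a \<bullet> \<phi> t - d)"
proof -
  \<comment> \<open>Coordinate 0 carries the top frequency with its phase, coordinates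
    \<open>2 * j - 1\<close> and \<open>2 * j\<close> carry cosine and sine of frequency
    \<open>j\<close>.\<close>
  define e :: "nat \<Rightarrow> real \<Rightarrow> real" where
    "e i t = (if i = 0 then cos (real (Suc k) * t - \<omega>)
              else if odd i then cos (real ((i + 1) div 2) * t) else sin (real (i div 2) * t))" for i t
  obtain h where h: "bij_betw h (Basis :: 'a set) {..<2 * k + 1}"
    using ex_bij_betw_finite_nat[of "Basis :: 'a set"] assms by (auto simp: atLeast0LessThan)
  define \<phi> :: "real \<Rightarrow> 'a" where "\<phi> t = (\<Sum>b\<in>Basis. e (h b) t *\<^sub>R b)" for t
  have inner: "(\<Sum>b\<in>Basis. A (h b) *\<^sub>R b) \<bullet> \<phi> t
     = A 0 * cos (real (Suc k) * t - \<omega>)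
       + (\<Sum>j<k. A (2 * j + 1) * cos (real (Suc j) * t) + A (2 * j + 2) * sin (real (Suc j) * t))" for A t
  proof -
    have "(\<Sum>b\<in>Basis. A (h b) *\<^sub>R b) \<bullet> \<phi> t = (\<Sum>b\<in>Basis. A (h b) * e (h b) t)"
      unfolding \<phi>_def by (simp add: inner_sum_right inner_sum_left_Basis mult.commute)
    also have "\<dots> = (\<Sum>i<2 * k + 1. A i * e i t)"
      by (rule sum.reindex_bij_betw[OF h])
    also have "\<dots> = A 0 * cos (real (Suc k) * t - \<omega>)
       + (\<Sum>j<k. A (2 * j + 1) * cos (real (Suc j) * t) + A (2 * j + 2) * sin (real (Suc j) * t))"
      unfolding sum_odd_even_split by (simp add: e_def)
    finally show ?thesis .
  qed
  show thesis
  proof (rule that, rule iffI)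
    fix p
    assume "trig_form k \<omega> p"
    then obtain q \<beta> where q: "trig_poly k q"
      and p: "\<And>t. p t = q t + \<beta> * cos (real (Suc k) * t - \<omega>)" by (elim trig_formE) blast
    obtain a b where q': "\<And>t. q t = (\<Sum>j\<le>k. a j * cos (real j * t) + b j * sin (real j * t))"
      using q unfolding trig_poly_def by blast
    define A where "A i = (if i = 0 then \<beta> else if odd i then a ((i + 1) div 2) else b (i div 2))" for i
    have "p t = (\<Sum>b\<in>Basis. A (h b) *\<^sub>R b) \<bullet> \<phi> t - (- a 0)" for t
    proof -
      have "q t = a 0 + (\<Sum>j<k. a (Suc j) * cos (real (Suc j) * t) + b (Suc j) * sin (real (Suc j) * t))"
        unfolding q' lessThan_Suc_atMost[symmetric] sum.lessThan_Suc_shift by simp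
      then show ?thesis unfolding inner p by (simp add: A_def)
    qed
    then show "\<exists>a d. \<forall>t. p t = a \<bullet> \<phi> t - d" by blast
  next
    fix p
    assume "\<exists>a d. \<forall>t. p t = a \<bullet> \<phi> t - d"
    then obtain a d where p: "\<And>t. p t = a \<bullet> \<phi> t - d" by blast
    define A where "A i = a \<bullet> inv_into Basis h i" for i
    have "a = (\<Sum>b\<in>Basis. A (h b) *\<^sub>R b)"
    proof -
      have "A (h b) = a \<bullet> b" if "b \<in> Basis" for b
        using that h unfolding A_def bij_betw_def by simp
      then have "(\<Sum>b\<in>Basis. A (h b) *\<^sub>R b) = (\<Sum>b\<in>Basis. (a \<bullet> b) *\<^sub>R b)"
        by (intro sum.cong) auto
      then show ?thesis by (simp add: euclidean_representation)
    qed
    then have "a \<bullet> \<phi> t = A 0 * cos (real (Suc k) * t - \<omega>)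
       + (\<Sum>j<k. A (2 * j + 1) * cos (real (Suc j) * t) + A (2 * j + 2) * sin (real (Suc j) * t))" for t
      using inner by metis
    then have "p = (\<lambda>t. ((\<Sum>j<k. A (2 * j + 1) * cos (real (Suc j) * t)
         + A (2 * j + 2) * sin (real (Suc j) * t)) + (- d)) + A 0 * cos (real (Suc k) * t - \<omega>))"
      unfolding p fun_eq_iff by simp
    moreover have "trig_poly k (\<lambda>t. (\<Sum>j<k. A (2 * j + 1) * cos (real (Suc j) * t)
         + A (2 * j + 2) * sin (real (Suc j) * t)) + (- d))"
      by (intro trig_poly_add trig_poly_sum trig_poly_sin_cos trig_poly_const) auto
    ultimately show "trig_form k \<omega> p" by (rule trig_formI[rotated])
  qed
qed

text \<open>The real line modulo \<open>L\<close> models the circle: \<open>x\<close> lists the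
  points of all turns, and \<open>c\<close> is \<open>2 * \<omega>\<close> rescaled. By
  \<open>generic\<close> no \<open>2 * k + 2\<close> points, even with repetition, have the critical
  sum; \<open>gap\<close> and \<open>L\<close> limit how far sums of zeros can move.\<close>

locale moment_config =
  fixes k n :: nat and L c :: real and x :: "int \<Rightarrow> real"
  assumes k: "1 \<le> k" and n: "2 * k + 4 \<le> n"
    and mono: "strict_mono x"
    and period: "x (i + int n) = x i + L"
    and gap: "x (i + 1) - x i \<le> 1"
    and L: "2 * real k + 4 \<le> L"
    and generic: "(\<Sum>j<2 * Suc k. x (f j)) \<noteq> c + L * of_int z"
begin

section \<open>Half-angle sines at configuration points and products with prescribed zeros\<close>

definition angle :: "int \<Rightarrow> real" where "angle i = 2 * pi * x i / L"

lemma L_pos: "0 < L" using L by linarith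

lemma x_shift: "x (i + int n * q) = x i + L * of_int q"
proof (induction q rule: int_induct[where k = 0])
  case base show ?case by simp
next
  case (step1 q)
  then show ?case using period[of "i + int n * q"] by (simp add: algebra_simps)
next
  case (step2 q)
  then show ?case using period[of "i + int n * (q - 1)"] by (simp add: algebra_simps)
qed

lemma x_less: "i < j \<Longrightarrow> x i < x j" and x_le: "i \<le> j \<Longrightarrow> x i \<le> x j"
  using mono by (simp_all add: strict_mono_less strict_mono_less_eq)

lemma sin_angle_pos:
  assumes "v < u" "u < v + int n"
  shows "0 < sin ((angle u - angle v) / 2)"
proof (rule sin_gt_zero)
  have eq: "(angle u - angle v) / 2 = pi * (x u - x v) / L"
    by (simp add: angle_def diff_divide_distrib right_diff_distrib)
  have "0 < x u - x v" "x u - x v < L"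
    using x_less[OF assms(1)] x_less[OF assms(2)] period[of v] by auto
  then show "0 < (angle u - angle v) / 2" "(angle u - angle v) / 2 < pi"
    unfolding eq using L_pos by (simp_all add: pos_divide_less_eq)
qed

lemma sin_shift_int: "sin (s + pi * of_int q) = cos (pi * of_int q) * sin s"
proof -
  have "sin (pi * of_int q) = 0" by (simp add: sin_zero_iff_int2 mult.commute)
  then show ?thesis by (simp add: sin_add)
qed

lemma cos_int_neq_0: "cos (pi * of_int q) \<noteq> 0"
proof -
  have "sin (pi * of_int q) = 0" by (simp add: sin_zero_iff_int2 mult.commute)
  then show ?thesis using sin_zero_norm_cos_one by fastforce
qed

lemma sin_zero_imp:
  assumes "sin ((angle i - 2 * pi * y / L) / 2) = 0"
  obtains z :: int where "y = x i + L * of_int z"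
proof -
  obtain z :: int where "(angle i - 2 * pi * y / L) / 2 = of_int z * pi"
    using assms unfolding sin_zero_iff_int2 by blast
  then have "pi * (x i - y) = pi * (of_int z * L)"
    unfolding angle_def using L_pos by (simp add: field_simps)
  then have "x i - y = of_int z * L" by simp
  then have "y = x i + L * of_int (- z)" by (simp add: algebra_simps)
  then show thesis by (rule that)
qed

definition root_prod :: "(nat \<Rightarrow> real) \<Rightarrow> real \<Rightarrow> real" where
  "root_prod y t = (\<Prod>i<2 * Suc k. sin ((t - 2 * pi * y i / L) / 2))"

text \<open>In the scale of \<open>x\<close> half the sum of the angles is \<open>pi / L\<close>
  times the sum of the \<open>y i\<close>, so a multiple of \<open>L\<close> costs only a multiple
  of pi in the phase.\<close>

lemma root_prod_form:
  assumes "(\<Sum>i<2 * Suc k. y i) = c + L * of_int z"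
  shows "trig_form k (pi * c / L) (root_prod y)"
proof (rule trig_form_shift)
  show "trig_form k ((\<Sum>i<2 * Suc k. 2 * pi * y i / L) / 2) (root_prod y)"
    unfolding root_prod_def by (rule prod_sin_trig_form)
  have "(\<Sum>i<2 * Suc k. 2 * pi * y i / L) = 2 * pi / L * (c + L * of_int z)"
    unfolding assms[symmetric] sum_distrib_left by (intro sum.cong) auto
  then show "(\<Sum>i<2 * Suc k. 2 * pi * y i / L) / 2 = pi * c / L + pi * of_int z"
    using L_pos by (simp add: field_simps)
qed

lemma root_prod_zero: "root_prod y (angle i) = 0" if "j < 2 * Suc k" "y j = x i"
proof -
  have "sin ((angle i - 2 * pi * y j / L) / 2) = 0" using that by (simp add: angle_def)
  then show ?thesis unfolding root_prod_def using that(1) by (subst prod_zero_iff) (simp, blast)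
qed

lemma root_prod_zeroE:
  assumes "root_prod y (angle i) = 0"
  obtains j z where "j < 2 * Suc k" "y j = x i + L * of_int z"
proof -
  obtain j where j: "j < 2 * Suc k" "sin ((angle i - 2 * pi * y j / L) / 2) = 0"
    using assms unfolding root_prod_def by (subst (asm) prod_zero_iff) (simp, blast)
  obtain z where "y j = x i + L * of_int z" using j(2) by (rule sin_zero_imp)
  then show thesis using that j(1) by blast
qed

text \<open>The trace of a supporting hyperplane on the curve. Nonnegativity is asked only at the
  configuration points; between them the function may be negative.\<close>

definition supp :: "int set \<Rightarrow> bool" where
  "supp F \<longleftrightarrow> (\<exists>p. trig_form k (pi * c / L) p \<and> (\<forall>i. 0 \<le> p (angle i))
      \<and> (\<forall>i\<in>F. p (angle i) = 0) \<and> (\<exists>i. p (angle i) \<noteq> 0))"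

end

section \<open>Convex hulls of points on the curve\<close>

locale moment_polytope = moment_config k n L c x for k n L c x +
  fixes \<phi> :: "real \<Rightarrow> 'a::euclidean_space"
  assumes dim: "DIM('a) = 2 * k + 1"
    and form_iff: "trig_form k (pi * c / L) p \<longleftrightarrow> (\<exists>a d. \<forall>t. p t = a \<bullet> \<phi> t - d)"
begin

definition pt :: "int \<Rightarrow> 'a" where "pt i = \<phi> (angle i)"

definition V :: "'a set" where "V = pt ` {0..<int n}"

definition P :: "'a set" where "P = convex hull V"

lemma pt_period: "pt (i + int n * q) = pt i"
proof -
  \<comment> \<open>Every linear functional of the curve is a trigonometric form, hence periodic,
    and linear functionals separate points.\<close>
  have step: "\<phi> (t + 2 * pi) = \<phi> t" for t
  proof -
    have "a \<bullet> \<phi> (t + 2 * pi) = a \<bullet> \<phi> t" for a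
    proof -
      have "trig_form k (pi * c / L) (\<lambda>t. a \<bullet> \<phi> t)"
        unfolding form_iff by (intro exI[of _ a] exI[of _ 0]) simp
      then show ?thesis using trig_form_periodic by blast
    qed
    then show ?thesis using vector_eq_ldot by blast
  qed
  have one: "pt (i + int n) = pt i" for i
    using step[of "angle i"] L_pos unfolding pt_def angle_def period
    by (simp add: add_divide_distrib distrib_left)
  show ?thesis
  proof (induction q rule: int_induct[where k = 0])
    case base show ?case by simp
  next
    case (step1 q)
    then show ?case using one[of "i + int n * q"] by (simp add: algebra_simps)
  next
    case (step2 q)
    then show ?case using one[of "i + int n * (q - 1)"] by (simp add: algebra_simps)
  qed
qed

lemma pt_mod: "pt (i mod int n) = pt i"
  using pt_period[of "i mod int n" "i div int n"] by simp

lemma pt_in_V: "pt i \<in> V"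
proof -
  have "i mod int n \<in> {0..<int n}" using n by simp
  then show ?thesis unfolding V_def pt_mod[of i, symmetric] by blast
qed

lemma window_rep:
  assumes "v \<in> V"
  obtains i where "g \<le> i" "i < g + int n" "v = pt i"
proof -
  obtain j where "v = pt j" using assms unfolding V_def by blast
  then have "v = pt (g + (j - g) mod int n)"
    using pt_mod[of "j"] pt_period[of "g + (j - g) mod int n" "(j - g) div int n"] by simp
  moreover have "g \<le> g + (j - g) mod int n" "g + (j - g) mod int n < g + int n" using n by simp_all
  ultimately show thesis using that by blast
qed

lemma functional_dependence_zero:
  assumes "trig_form k (pi * c / L) p" "sum u I = 0" "(\<Sum>i\<in>I. u i *\<^sub>R pt i) = 0"
  shows "(\<Sum>i\<in>I. u i * p (angle i)) = 0"
proof -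
  obtain a d where p: "\<And>t. p t = a \<bullet> \<phi> t - d" using assms(1) form_iff by blast
  have "(\<Sum>i\<in>I. u i * p (angle i)) = a \<bullet> (\<Sum>i\<in>I. u i *\<^sub>R pt i) - d * sum u I"
    unfolding p inner_sum_right sum_distrib_left sum_subtractf[symmetric]
    by (intro sum.cong) (auto simp: pt_def algebra_simps)
  then show ?thesis using assms by simp
qed

text \<open>A product with zeros at all points of \<open>I\<close> except \<open>i0\<close> isolates
  the coefficient of \<open>i0\<close>. Its last zero is forced by the prescribed sum, and
  \<open>generic\<close> keeps it away from \<open>i0\<close>.\<close>

lemma no_dependence:
  assumes I: "I \<subseteq> {0..<int n}" "card I = 2 * Suc k"
    and u: "sum u I = 0" "(\<Sum>i\<in>I. u i *\<^sub>R pt i) = 0" and i0: "i0 \<in> I"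
  shows "u i0 = 0"
proof -
  have fin: "finite I" using I(1) finite_subset by blast
  have "card (I - {i0}) = Suc (2 * k)" using I(2) i0 by simp
  then obtain f where f: "bij_betw f {..<Suc (2 * k)} (I - {i0})"
    using ex_bij_betw_nat_finite[of "I - {i0}"] fin by (auto simp: atLeast0LessThan)
  define r where "r = c - (\<Sum>i<Suc (2 * k). x (f i))"
  define y where "y i = (if i < Suc (2 * k) then x (f i) else r)" for i
  have two: "2 * Suc k = Suc (Suc (2 * k))" by simp
  have "(\<Sum>i<2 * Suc k. y i) = c + L * of_int 0"
    unfolding two sum.lessThan_Suc[of _ "Suc (2 * k)"] by (simp add: y_def r_def)
  then have form: "trig_form k (pi * c / L) (root_prod y)" by (rule root_prod_form)
  have zero: "root_prod y (angle i) = 0" if "i \<in> I - {i0}" for i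
  proof -
    obtain j where "j < Suc (2 * k)" "f j = i"
      using f \<open>i \<in> I - {i0}\<close> unfolding bij_betw_def by (metis imageE lessThan_iff)
    then show ?thesis by (intro root_prod_zero[of j]) (auto simp: y_def)
  qed
  have "root_prod y (angle i0) \<noteq> 0"
  proof
    assume "root_prod y (angle i0) = 0"
    then obtain j z where j: "j < 2 * Suc k" "y j = x i0 + L * of_int z" by (rule root_prod_zeroE)
    show False
    proof (cases "j < Suc (2 * k)")
      case True
      then have "f j \<in> I - {i0}" using f bij_betwE by fastforce
      moreover have "x (f j) = x (i0 + int n * z)" using j True by (simp add: y_def x_shift)
      then have "f j = i0 + int n * z" using mono strict_mono_eq by blast
      ultimately have *: "f j \<noteq> i0" "f j = i0 + int n * z" "0 \<le> f j" "f j < int n" "0 \<le> i0" "i0 < int n"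
        using I i0 by auto
      then have "z \<noteq> 0" by auto
      moreover from * have "int n * z < int n * 1" "int n * (-1) < int n * z" by linarith+
      ultimately show False unfolding mult_less_cancel_left by auto
    next
      \<comment> \<open>If the forced zero fell on \<open>i0\<close>, the \<open>2 * k + 2\<close>
        points of \<open>I\<close> would have the critical sum.\<close>
      case False
      then have "r = x i0 + L * of_int z" using j by (simp add: y_def)
      then have "(\<Sum>i<2 * Suc k. x ((f(Suc (2 * k) := i0)) i)) = c + L * of_int (- z)"
        unfolding two sum.lessThan_Suc[of _ "Suc (2 * k)"] by (simp add: r_def)
      then show False using generic by blast
    qed
  qed
  moreover have "(\<Sum>i\<in>I. u i * root_prod y (angle i)) = u i0 * root_prod y (angle i0)"
    using fin i0 zero by (subst sum.remove[of _ i0]) auto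
  ultimately show ?thesis using functional_dependence_zero[OF form u] by simp
qed

section \<open>General position of the vertices and dimension of the hull\<close>

lemma window_superset:
  assumes "J \<subseteq> {0..<int n}" "card J \<le> 2 * Suc k"
  obtains I where "J \<subseteq> I" "I \<subseteq> {0..<int n}" "card I = 2 * Suc k"
  using exists_subset_between[of J "2 * Suc k" "{0..<int n}"] assms n by auto

lemma pt_inj: "inj_on pt {0..<int n}"
proof
  fix i j assume ij: "i \<in> {0..<int n}" "j \<in> {0..<int n}" "pt i = pt j"
  show "i = j"
  proof (rule ccontr)
    assume "i \<noteq> j"
    obtain I where I: "{i, j} \<subseteq> I" "I \<subseteq> {0..<int n}" "card I = 2 * Suc k"
      by (rule window_superset[of "{i,j}"]) (use ij k \<open>i \<noteq> j\<close> in auto)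
    have fin: "finite I" using I(2) finite_subset by blast
    define u where "u l = (if l = i then 1 else if l = j then -1 else (0::real))" for l
    have "sum u I = sum u {i, j}"
      using I fin by (intro sum.mono_neutral_right) (auto simp: u_def)
    moreover have "(\<Sum>l\<in>I. u l *\<^sub>R pt l) = (\<Sum>l\<in>{i,j}. u l *\<^sub>R pt l)"
      using I fin by (intro sum.mono_neutral_right) (auto simp: u_def)
    ultimately have "sum u I = 0" "(\<Sum>l\<in>I. u l *\<^sub>R pt l) = 0"
      using \<open>i \<noteq> j\<close> ij(3) by (simp_all add: u_def)
    then have "u i = 0" using no_dependence[OF I(2,3)] I(1) by blast
    then show False by (simp add: u_def)
  qed
qed

lemma card_V: "card V = n"
  unfolding V_def using pt_inj by (simp add: card_image)

lemma finite_V: "finite V"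
  unfolding V_def by simp

text \<open>A dependence of fewer points is extended by zero coefficients to
  \<open>2 * k + 2\<close> indices, where \<open>no_dependence\<close> applies.\<close>

lemma affine_independent_V:
  assumes "T \<subseteq> V" "card T \<le> 2 * Suc k"
  shows "\<not> affine_dependent T"
proof
  assume dep: "affine_dependent T"
  have "finite T" using assms(1) finite_V finite_subset by blast
  obtain J where J: "J \<subseteq> {0..<int n}" "T = pt ` J"
    using assms(1) unfolding V_def by (rule subset_imageE)
  have inj: "inj_on pt J" using pt_inj J(1) inj_on_subset by blast
  then have "card J \<le> 2 * Suc k" using assms(2) J(2) by (simp add: card_image)
  then obtain I where I: "J \<subseteq> I" "I \<subseteq> {0..<int n}" "card I = 2 * Suc k"
    using J(1) window_superset by blast
  have fin: "finite I" using I(2) finite_subset by blast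
  obtain U v where U: "sum U T = 0" "v \<in> T" "U v \<noteq> 0" "(\<Sum>v\<in>T. U v *\<^sub>R v) = 0"
    using dep unfolding affine_dependent_explicit_finite[OF \<open>finite T\<close>] by blast
  define u where "u i = (if i \<in> J then U (pt i) else 0)" for i
  have "sum u I = sum u J"
    using I fin by (intro sum.mono_neutral_right) (auto simp: u_def)
  also have "\<dots> = sum U T" unfolding J(2) sum.reindex[OF inj] by (simp add: u_def)
  finally have 1: "sum u I = 0" using U by simp
  have "(\<Sum>l\<in>I. u l *\<^sub>R pt l) = (\<Sum>l\<in>J. u l *\<^sub>R pt l)"
    using I fin by (intro sum.mono_neutral_right) (auto simp: u_def)
  also have "\<dots> = (\<Sum>v\<in>T. U v *\<^sub>R v)" unfolding J(2) sum.reindex[OF inj] by (simp add: u_def)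
  finally have 2: "(\<Sum>l\<in>I. u l *\<^sub>R pt l) = 0" using U by simp
  obtain i where i: "i \<in> J" "v = pt i" using U(2) J(2) by blast
  then have "u i = 0" using no_dependence[OF I(2,3) 1 2] I(1) by blast
  then show False using U(3) i by (simp add: u_def)
qed

lemma aff_dim_big:
  assumes "T \<subseteq> V" "2 * Suc k \<le> card T"
  shows "2 * int k + 1 \<le> aff_dim T"
proof -
  obtain S where S: "S \<subseteq> T" "card S = 2 * Suc k"
    using obtain_subset_with_card_n[OF assms(2)] by blast
  then have "\<not> affine_dependent S" using assms(1) by (intro affine_independent_V) auto
  then have "int (card S) = aff_dim S + 1" by (rule aff_dim_affine_independent)
  then show ?thesis using S aff_dim_subset[OF S(1)] by simp
qed

lemma aff_dim_P: "aff_dim P = int (2 * k + 1)"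
proof -
  have "2 * int k + 1 \<le> aff_dim V" using card_V n by (intro aff_dim_big) auto
  moreover have "aff_dim V \<le> int (2 * k + 1)" using aff_dim_le_DIM[of V] dim by simp
  ultimately show ?thesis unfolding P_def aff_dim_convex_hull by simp
qed

section \<open>Faces and supporting functions\<close>

lemma polytope_P: "polytope P"
  unfolding P_def polytope_def using finite_V by blast

lemma V_subset_P: "V \<subseteq> P"
  unfolding P_def by (rule hull_subset)

text \<open>A proper face has dimension below \<open>2 * k + 1\<close>, so by
  \<open>aff_dim_big\<close> it contains too few points of \<open>V\<close> for these to be affinely
  dependent.\<close>

lemma proper_face:
  assumes "F face_of P" "F \<noteq> P"
  shows "F = convex hull (V \<inter> F)" "\<not> affine_dependent (V \<inter> F)"
proof -
  obtain S where S: "S \<subseteq> V" "F = convex hull S"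
    using face_of_convex_hull_subset[of V F] assms(1) finite_V finite_imp_compact
    unfolding P_def by blast
  have "convex hull (V \<inter> F) \<subseteq> F"
    using face_of_imp_convex[OF assms(1)] by (intro hull_minimal) auto
  moreover have "S \<subseteq> V \<inter> F" using S hull_subset by fastforce
  then have "F \<subseteq> convex hull (V \<inter> F)" unfolding S(2) by (rule hull_mono)
  ultimately show F: "F = convex hull (V \<inter> F)" by blast
  show "\<not> affine_dependent (V \<inter> F)"
  proof (rule affine_independent_V)
    have "aff_dim F < aff_dim P"
      using assms polytope_P by (intro face_of_aff_dim_lt polytope_imp_convex)
    then have "aff_dim (V \<inter> F) < 2 * int k + 1"
      using aff_dim_convex_hull[of "V \<inter> F"] F aff_dim_P by simp
    then show "card (V \<inter> F) \<le> 2 * Suc k" using aff_dim_big[of "V \<inter> F"] by fastforce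
  qed simp
qed

lemma simplicial_P: "simplicial_polytope P"
  unfolding simplicial_polytope_def
proof (intro conjI allI impI polytope_P)
  fix F assume "F face_of P \<and> F \<noteq> P"
  then have F: "F = convex hull (V \<inter> F)" "\<not> affine_dependent (V \<inter> F)"
    using proper_face by blast+
  then have "(int (card (V \<inter> F)) - 1) simplex (convex hull (V \<inter> F))"
    by (intro simplex_convex_hull) simp
  then show "\<exists>m. m simplex F" using F(1) by metis
qed

text \<open>The hyperplane may contain more vertices than \<open>T\<close>, but the face it cuts out
  is a simplex, and every subset of its vertices spans a face.\<close>

lemma supp_imp_boundary:
  assumes T: "T \<subseteq> V" and "supp {i. pt i \<in> T}"
  shows "T \<in> boundary_complex P"
proof -
  obtain p i0 where p: "trig_form k (pi * c / L) p" "\<And>i. 0 \<le> p (angle i)"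
    "\<And>i. pt i \<in> T \<Longrightarrow> p (angle i) = 0" "p (angle i0) \<noteq> 0"
    using assms(2) unfolding supp_def by blast
  obtain a d where ad: "\<And>t. p t = a \<bullet> \<phi> t - d" using p(1) form_iff by blast
  define F where "F = P \<inter> {y. a \<bullet> y = d}"
  have "V \<subseteq> {y. d \<le> a \<bullet> y}" using p(2) ad by (auto simp: V_def pt_def)
  then have "P \<subseteq> {y. d \<le> a \<bullet> y}"
    unfolding P_def by (intro hull_minimal) (auto simp: convex_halfspace_ge)
  then have face: "F face_of P" unfolding F_def
    by (intro face_of_Int_supporting_hyperplane_ge polytope_imp_convex polytope_P) auto
  have "pt i0 \<in> P" "pt i0 \<notin> F"
    using V_subset_P pt_in_V p(4) ad by (auto simp: F_def pt_def)
  then have "F \<noteq> P" by blast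
  have TF: "T \<subseteq> V \<inter> F"
  proof
    fix v assume "v \<in> T"
    then obtain i where "v = pt i" using T unfolding V_def by blast
    then show "v \<in> V \<inter> F"
      using \<open>v \<in> T\<close> T V_subset_P p(3)[of i] ad by (auto simp: F_def pt_def)
  qed
  note proper = proper_face[OF face \<open>F \<noteq> P\<close>]
  have "convex hull T face_of F"
    using face_of_convex_hull_affine_independent[OF proper(2)] TF proper(1) by metis
  then have "convex hull T face_of P" using face face_of_trans by blast
  moreover have "convex hull T \<noteq> P"
    using \<open>convex hull T face_of F\<close> \<open>pt i0 \<in> P\<close> \<open>pt i0 \<notin> F\<close> face_of_imp_subset by blast
  moreover have "\<not> affine_dependent T" using affine_independent_subset[OF proper(2) TF] .
  then have "vertices (convex hull T) = T"
    by (simp add: vertices_def extreme_point_of_convex_hull_affine_independent)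
  ultimately show ?thesis unfolding boundary_complex_def by blast
qed

text \<open>Every face of a polytope is exposed. The exposing functional is bounded above on
  \<open>P\<close>, so its negative restricts to a supporting function.\<close>

lemma boundary_imp_supp:
  assumes "T \<in> boundary_complex P"
  shows "supp {i. pt i \<in> T}"
proof -
  obtain F where F: "T = vertices F" "F face_of P" "F \<noteq> P"
    using assms unfolding boundary_complex_def by blast
  then have "F exposed_face_of P"
    using exposed_face_of_polyhedron polytope_imp_polyhedron polytope_P by blast
  then obtain a b where ab: "P \<subseteq> {y. a \<bullet> y \<le> b}" "F = P \<inter> {y. a \<bullet> y = b}"
    unfolding exposed_face_of_def by blast
  define p where "p t = (- a) \<bullet> \<phi> t - (- b)" for t
  have "trig_form k (pi * c / L) p" unfolding form_iff p_def by blast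
  moreover have "0 \<le> p (angle i)" for i
    using ab(1) V_subset_P pt_in_V[of i] by (auto simp: p_def pt_def)
  moreover have "p (angle i) = 0" if "pt i \<in> T" for i
    using that F(1) ab(2) by (auto simp: vertices_def extreme_point_of_def p_def pt_def)
  moreover have "\<exists>i. p (angle i) \<noteq> 0"
  proof (rule ccontr)
    assume "\<not> ?thesis"
    then have "V \<subseteq> F" using V_subset_P by (auto simp: ab(2) V_def p_def pt_def)
    then have "P \<subseteq> F" unfolding P_def
      using face_of_imp_convex[OF F(2)] by (intro hull_minimal)
    then show False using F(2,3) face_of_imp_subset by blast
  qed
  ultimately show ?thesis unfolding supp_def by blast
qed

end

section \<open>Separated sequences\<close>

text \<open>Induction splits off the maximum and its predecessor. \<open>b\<close> is greedy from
  the right and \<open>a\<close> from the left; equal length and a difference of at most 1 at each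
  index later allow moving from one to the other by single steps.\<close>

lemma greedy_pairs:
  fixes F :: "int set"
  assumes "finite F"
  shows "\<exists>m a b. (\<forall>j<m. a j \<in> F \<and> b j \<in> F \<and> a j \<le> b j \<and> b j \<le> a j + 1)
     \<and> (\<forall>j. Suc j < m \<longrightarrow> a j + 2 \<le> a (Suc j) \<and> b j + 2 \<le> b (Suc j))
     \<and> (\<forall>i\<in>F. \<exists>j<m. i = a j \<or> i = a j + 1)
     \<and> (\<forall>i\<in>F. \<exists>j<m. i = b j - 1 \<or> i = b j)"
  using assms
proof (induction rule: finite_psubset_induct)
  case (psubset F)
  show ?case
  proof (cases "F = {}")
    case True
    then show ?thesis by (intro exI[of _ "0::nat"]) auto
  next
    case False
    define z where "z = Max F"
    have zF: "z \<in> F" unfolding z_def by (rule Max_in[OF \<open>finite F\<close> False])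
    have zmax: "i \<le> z" if "i \<in> F" for i
      unfolding z_def by (rule Max_ge[OF \<open>finite F\<close> that])
    define F' where "F' = {i \<in> F. i < z - 1}"
    have "F' \<subseteq> F" "z \<notin> F'" unfolding F'_def by auto
    then have "F' \<subset> F" using zF by blast
    from psubset.IH[OF this] obtain m a b where
      ab': "\<forall>j<m. a j \<in> F' \<and> b j \<in> F' \<and> a j \<le> b j \<and> b j \<le> a j + 1"
      and sep: "\<forall>j. Suc j < m \<longrightarrow> a j + 2 \<le> a (Suc j) \<and> b j + 2 \<le> b (Suc j)"
      and ca: "\<forall>i\<in>F'. \<exists>j<m. i = a j \<or> i = a j + 1"
      and cb: "\<forall>i\<in>F'. \<exists>j<m. i = b j - 1 \<or> i = b j"
      by (elim exE conjE)
    have ab: "a j \<in> F'" "b j \<in> F'" "a j \<le> b j" "b j \<le> a j + 1" if "j < m" for j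
      using ab' that by blast+
    \<comment> \<open>\<open>a\<close> takes \<open>z - 1\<close> only if it lies in
      \<open>F\<close> and is not yet covered from the left; the new pair then covers
      \<open>z\<close> as well.\<close>
    define w where "w = (if z - 1 \<in> F \<and> (\<forall>j<m. a j + 1 \<noteq> z - 1) then z - 1 else z)"
    define a' b' where "a' = a(m := w)" and "b' = b(m := z)"
    have w: "w \<in> F" "w \<le> z" "z \<le> w + 1" using zF by (auto simp: w_def)
    have aw: "a j + 2 \<le> w" if "j < m" for j
      using ab[OF that] that by (auto simp: w_def F'_def)
    have bz: "b j + 2 \<le> z" if "j < m" for j using ab[OF that] by (auto simp: F'_def)
    have split: "i \<in> F' \<or> i = z - 1 \<or> i = z" if "i \<in> F" for i
      using zmax[OF that] that by (auto simp: F'_def)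
    have "\<forall>j<Suc m. a' j \<in> F \<and> b' j \<in> F \<and> a' j \<le> b' j \<and> b' j \<le> a' j + 1"
      using ab w zF by (auto simp: a'_def b'_def less_Suc_eq F'_def)
    moreover have "\<forall>j. Suc j < Suc m \<longrightarrow> a' j + 2 \<le> a' (Suc j) \<and> b' j + 2 \<le> b' (Suc j)"
      using sep aw bz by (auto simp: a'_def b'_def less_Suc_eq)
    moreover have "\<exists>j<Suc m. i = a' j \<or> i = a' j + 1" if "i \<in> F" for i
    proof (cases "i \<in> F'")
      case True
      then obtain j where "j < m" "i = a j \<or> i = a j + 1" using ca by blast
      then show ?thesis by (intro exI[of _ j]) (auto simp: a'_def)
    next
      case False
      then consider "i = w \<or> i = w + 1" | j where "j < m" "i = a j + 1"
        using split[OF \<open>i \<in> F\<close>] \<open>i \<in> F\<close> w by (auto simp: w_def split: if_splits)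
      then show ?thesis
      proof cases
        case 1
        then show ?thesis by (intro exI[of _ m]) (auto simp: a'_def)
      next
        case 2
        then show ?thesis by (intro exI[of _ j]) (auto simp: a'_def)
      qed
    qed
    moreover have "\<exists>j<Suc m. i = b' j - 1 \<or> i = b' j" if "i \<in> F" for i
    proof (cases "i \<in> F'")
      case True
      then obtain j where "j < m" "i = b j - 1 \<or> i = b j" using cb by blast
      then show ?thesis by (intro exI[of _ j]) (auto simp: b'_def)
    next
      case False
      then show ?thesis using split[OF that] by (intro exI[of _ m]) (auto simp: b'_def)
    qed
    ultimately show ?thesis by blast
  qed
qed

lemma prod_pairs: "(\<Prod>i<2 * m. g i) = (\<Prod>j<m. g (2 * j) * g (2 * j + 1))"
  for g :: "nat \<Rightarrow> 'b::comm_monoid_mult"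
proof (induction m)
  case (Suc m)
  have "2 * Suc m = Suc (Suc (2 * m))" by simp
  then show ?case by (simp only: prod.lessThan_Suc Suc) (simp add: mult.assoc)
qed simp

lemma sum_pairs: "(\<Sum>i<2 * m. g i) = (\<Sum>j<m. g (2 * j) + g (2 * j + 1))"
  for g :: "nat \<Rightarrow> 'b::comm_monoid_add"
proof (induction m)
  case (Suc m)
  have "2 * Suc m = Suc (Suc (2 * m))" by simp
  then show ?case by (simp only: sum.lessThan_Suc Suc) (simp add: add.assoc)
qed simp

section \<open>Nonadjacent vertices and the necessary condition for faces\<close>

context moment_config
begin

text \<open>Representatives of \<open>m\<close> pairwise nonadjacent vertices on a cycle of length
  \<open>n\<close>; the last conjunct is nonadjacency across the seam.\<close>

definition sepseq :: "nat \<Rightarrow> (nat \<Rightarrow> int) \<Rightarrow> bool" where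
  "sepseq m f \<longleftrightarrow> (\<forall>j. Suc j < m \<longrightarrow> f j + 2 \<le> f (Suc j)) \<and> f (m - 1) + 2 \<le> f 0 + int n"

text \<open>With \<open>upper\<close> this bounds the sum of zeros when each chosen vertex carries
  one zero and a second one between its two neighbours.\<close>

definition lower :: "(nat \<Rightarrow> int) \<Rightarrow> real" where
  "lower f = (\<Sum>j<Suc k. x (f j) + x (f j - 1))"

definition upper :: "(nat \<Rightarrow> int) \<Rightarrow> real" where
  "upper f = (\<Sum>j<Suc k. x (f j) + x (f j + 1))"

definition good_at :: "int \<Rightarrow> (nat \<Rightarrow> int) \<Rightarrow> bool" where
  "good_at z f \<longleftrightarrow> lower f \<le> c + L * of_int z \<and> c + L * of_int z \<le> upper f"

lemma sepseq_less:
  assumes "sepseq m f" "i < j" "j < m"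
  shows "f i + 2 \<le> f j"
  using assms(2,3)
proof (induction j)
  case (Suc j)
  have "f j + 2 \<le> f (Suc j)" using assms(1) Suc.prems unfolding sepseq_def by blast
  then show ?case using Suc by (cases "i = j") auto
qed simp

lemma sepseq_wrap:
  assumes "sepseq m f" "i < j" "j < m"
  shows "f j + 2 \<le> f i + int n"
proof -
  have "j < m - 1 \<or> j = m - 1" using assms(3) by linarith
  then have "f j \<le> f (m - 1)" using sepseq_less[OF assms(1), of j "m - 1"] assms by auto
  moreover have "f 0 \<le> f i" using sepseq_less[OF assms(1), of 0 i] assms by (cases "i = 0") auto
  ultimately show ?thesis using assms(1) unfolding sepseq_def by linarith
qed

lemma form_angle_shift:
  assumes "trig_form k \<omega> p"
  shows "p (angle (i + int n * q)) = p (angle i)"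
proof -
  have one: "p (angle (i + int n)) = p (angle i)" for i
    using trig_form_periodic[OF assms, of "angle i"] L_pos unfolding angle_def period
    by (simp add: add_divide_distrib distrib_left)
  show ?thesis
  proof (induction q rule: int_induct[where k = 0])
    case base show ?case by simp
  next
    case (step1 q)
    then show ?case using one[of "i + int n * q"] by (simp add: algebra_simps)
  next
    case (step2 q)
    then show ?case using one[of "i + int n * (q - 1)"] by (simp add: algebra_simps)
  qed
qed

text \<open>Divided difference at the points \<open>f j\<close> and their neighbours
  \<open>f j + e\<close>. The former are zeros of \<open>p\<close>; the latter get weights of one
  sign, since both points of any other pair lie on the same side and only the own partner
  contributes the sign \<open>e\<close>.\<close>

lemma alternating_weights:
  assumes f: "sepseq (Suc k) f" and e: "e = 1 \<or> e = -1"
    and q: "trig_poly k q" and p: "\<And>t. p t = q t + \<beta> * cos (real (Suc k) * t - \<omega>)"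
    and zero: "\<And>j. j < Suc k \<Longrightarrow> p (angle (f j)) = 0"
  obtains w where "\<And>j. j < Suc k \<Longrightarrow> 0 < w j"
    "of_int e * (\<Sum>j<Suc k. w j * p (angle (f j + e)))
      = - 2 * (-4) ^ k * \<beta> * sin ((\<Sum>j<Suc k. angle (f j) + angle (f j + e)) / 2 - \<omega>)"
proof -
  \<comment> \<open>The tag \<open>False\<close> marks the point \<open>f j\<close> itself,
    \<open>True\<close> its neighbour \<open>f j + e\<close>.\<close>
  define I where "I = {..<Suc k} \<times> (UNIV :: bool set)"
  define idx where "idx = (\<lambda>(j, b). f j + (if b then e else 0))"
  define \<theta> where "\<theta> = angle \<circ> idx"
  have fin: "finite I" "card I = 2 * Suc k" by (simp_all add: I_def card_cartesian_product)
  have pos: "0 < sin ((\<theta> (j, b) - \<theta> (i, b')) / 2)"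
    and neg: "sin ((\<theta> (i, b') - \<theta> (j, b)) / 2) < 0" if "i < j" "j < Suc k" for i j b b'
  proof -
    have "idx (i, b') < idx (j, b)" "idx (j, b) < idx (i, b') + int n"
      using sepseq_less[OF f that] sepseq_wrap[OF f that] e by (auto simp: idx_def)
    then show *: "0 < sin ((\<theta> (j, b) - \<theta> (i, b')) / 2)"
      unfolding \<theta>_def comp_def by (rule sin_angle_pos)
    have "(\<theta> (i, b') - \<theta> (j, b)) / 2 = - ((\<theta> (j, b) - \<theta> (i, b')) / 2)"
      by (simp add: field_simps)
    then show "sin ((\<theta> (i, b') - \<theta> (j, b)) / 2) < 0" using * by (simp only: sin_minus)
  qed
  have same: "0 < of_int e * sin ((\<theta> (j, True) - \<theta> (j, False)) / 2)" for j
  proof -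
    have "0 < sin ((angle (f j + 1) - angle (f j)) / 2)" "0 < sin ((angle (f j) - angle (f j - 1)) / 2)"
      using n by (auto intro!: sin_angle_pos)
    moreover have "(angle (f j - 1) - angle (f j)) / 2 = - ((angle (f j) - angle (f j - 1)) / 2)"
      by (simp add: field_simps)
    then have "sin ((angle (f j - 1) - angle (f j)) / 2) = - sin ((angle (f j) - angle (f j - 1)) / 2)"
      by (simp only: sin_minus)
    ultimately show ?thesis using e by (auto simp: \<theta>_def idx_def)
  qed
  have dist: "sin ((\<theta> i - \<theta> j) / 2) \<noteq> 0" if "i \<in> I" "j \<in> I" "i \<noteq> j" for i j
  proof -
    obtain i' b j' b' where ij: "i = (i', b)" "j = (j', b')" by fastforce
    consider "i' < j'" | "j' < i'" | "i' = j'" "b \<noteq> b'"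
      using \<open>i \<noteq> j\<close> ij by (cases i' j' rule: linorder_cases) auto
    then show ?thesis
    proof cases
      case 1 then show ?thesis using neg[of i' j' b b'] that ij by (auto simp: I_def)
    next
      case 2 then show ?thesis using pos[of j' i' b b'] that ij by (auto simp: I_def)
    next
      case 3
      have "(\<theta> (j', False) - \<theta> (j', True)) / 2 = - ((\<theta> (j', True) - \<theta> (j', False)) / 2)"
        by (simp add: field_simps)
      then have "sin ((\<theta> (j', False) - \<theta> (j', True)) / 2) = - sin ((\<theta> (j', True) - \<theta> (j', False)) / 2)"
        by (simp only: sin_minus)
      then show ?thesis using 3 same[of j'] ij by (cases b) auto
    qed
  qed
  define D where "D i = (\<Prod>j\<in>I-{i}. sin ((\<theta> i - \<theta> j) / 2))" for i
  define w where "w j = of_int e / D (j, True)" for j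
  have dd: "(\<Sum>i\<in>I. p (\<theta> i) / D i) = - 2 * (-4) ^ k * \<beta> * sin ((\<Sum>i\<in>I. \<theta> i) / 2 - \<omega>)"
    unfolding D_def by (rule trig_poly_divided_difference[OF fin dist q p])
  have UB: "(UNIV :: bool set) = {False, True}" by auto
  have S: "(\<Sum>i\<in>I. \<theta> i) = (\<Sum>j<Suc k. angle (f j) + angle (f j + e))"
    unfolding I_def sum.cartesian_product[symmetric, where g = "\<lambda>x y. \<theta> (x, y)", simplified]
    by (simp add: \<theta>_def idx_def UB)
  have "(\<Sum>i\<in>I. p (\<theta> i) / D i) = (\<Sum>j<Suc k. \<Sum>b\<in>UNIV. p (\<theta> (j, b)) / D (j, b))"
    unfolding I_def by (simp only: sum.cartesian_product) (simp add: case_prod_unfold)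
  also have "\<dots> = (\<Sum>j<Suc k. p (angle (f j + e)) / D (j, True))"
    by (intro sum.cong refl) (use zero in \<open>auto simp: UB \<theta>_def idx_def\<close>)
  also have "\<dots> = of_int e * (\<Sum>j<Suc k. w j * p (angle (f j + e)))"
    unfolding sum_distrib_left w_def using e by (intro sum.cong) auto
  finally have eq: "of_int e * (\<Sum>j<Suc k. w j * p (angle (f j + e)))
      = - 2 * (-4) ^ k * \<beta> * sin ((\<Sum>j<Suc k. angle (f j) + angle (f j + e)) / 2 - \<omega>)"
    using dd S by simp
  have "0 < w j" if j: "j < Suc k" for j
  proof -
    define g where "g i = sin ((\<theta> (j, True) - \<theta> i) / 2)" for i
    have "I - {(j, True)} = insert (j, False) (({..<Suc k} - {j}) \<times> UNIV)"
      using j by (auto simp: I_def)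
    then have "D (j, True) = g (j, False) * (\<Prod>i\<in>({..<Suc k} - {j}) \<times> UNIV. g i)"
      unfolding D_def g_def[symmetric] by simp
    also have "(\<Prod>i\<in>({..<Suc k} - {j}) \<times> UNIV. g i) = (\<Prod>i\<in>{..<Suc k} - {j}. g (i, False) * g (i, True))"
      using prod.cartesian_product[of "\<lambda>x y. g (x, y)" UNIV "{..<Suc k} - {j}"]
      by (simp add: UB case_prod_unfold)
    finally have D: "D (j, True) = g (j, False) * (\<Prod>i\<in>{..<Suc k} - {j}. g (i, False) * g (i, True))" .
    have "0 < (\<Prod>i\<in>{..<Suc k} - {j}. g (i, False) * g (i, True))"
    proof (intro prod_pos)
      fix i assume "i \<in> {..<Suc k} - {j}"
      then consider "i < j" | "j < i" "i < Suc k" by fastforce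
      then show "0 < g (i, False) * g (i, True)"
      proof cases
        case 1 then show ?thesis using pos j unfolding g_def by (intro mult_pos_pos)
      next
        case 2 then show ?thesis using neg unfolding g_def by (intro mult_neg_neg)
      qed
    qed
    moreover have "0 < of_int e * g (j, False)" using same g_def by simp
    ultimately have "0 < of_int e * D (j, True)" unfolding D by (simp flip: mult.assoc)
    then show ?thesis using e by (auto simp: w_def zero_less_divide_iff)
  qed
  then show thesis using eq that by blast
qed

text \<open>Without a representative of \<open>c\<close> in between, \<open>u - c\<close> and
  \<open>v - c\<close> lie in one open interval between consecutive multiples of \<open>L\<close>,
  where the sine keeps its sign.\<close>

lemma sin_same_sign:
  assumes "\<not> (\<exists>z. u \<le> c + L * of_int z \<and> c + L * of_int z \<le> v)" "u \<le> v"
  shows "0 < sin (pi * (u - c) / L) * sin (pi * (v - c) / L)"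
proof -
  define z where "z = \<lfloor>(u - c) / L\<rfloor>"
  have "of_int z \<le> (u - c) / L" "(u - c) / L < of_int z + 1" unfolding z_def by linarith+
  then have "c + L * of_int z \<le> u" "u < c + L * of_int (z + 1)"
    using L_pos by (simp_all add: field_simps)
  then have z: "c + L * of_int z < u" "v < c + L * of_int (z + 1)"
    using assms(1)[unfolded not_ex, rule_format, of z]
      assms(1)[unfolded not_ex, rule_format, of "z + 1"] assms(2) by linarith+
  have "\<exists>s>0. sin (pi * (y - c) / L) = cos (pi * of_int z) * s" if "u \<le> y" "y \<le> v" for y
  proof (intro exI conjI)
    define r where "r = y - c - L * of_int z"
    have r: "0 < r" "r < L" using z that by (auto simp: r_def algebra_simps)
    then show "0 < sin (pi * r / L)"
      using L_pos by (intro sin_gt_zero) (auto simp: divide_less_eq)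
    have "pi * (y - c) / L = pi * r / L + pi * of_int z"
      unfolding r_def using L_pos by (simp add: field_simps)
    then show "sin (pi * (y - c) / L) = cos (pi * of_int z) * sin (pi * r / L)"
      by (simp only: sin_shift_int)
  qed
  from this[of u] this[of v] obtain s s' where
    "sin (pi * (u - c) / L) = cos (pi * of_int z) * s" "0 < s"
    "sin (pi * (v - c) / L) = cos (pi * of_int z) * s'" "0 < s'" using assms(2) by auto
  moreover have "0 < cos (pi * of_int z) * cos (pi * of_int z)"
    using cos_int_neq_0[of z] by (metis mult_eq_0_iff not_real_square_gt_zero)
  ultimately show ?thesis by (simp add: mult.assoc mult.left_commute mult_pos_pos)
qed

lemma sum_angle: "(\<Sum>j<Suc k. angle (f j) + angle (g j)) / 2 - pi * c / L
    = pi * ((\<Sum>j<Suc k. x (f j) + x (g j)) - c) / L"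
proof -
  have "(\<Sum>j<Suc k. angle (f j) + angle (g j)) = 2 * pi / L * (\<Sum>j<Suc k. x (f j) + x (g j))"
    unfolding sum_distrib_left angle_def by (intro sum.cong refl) (simp add: add_divide_distrib distrib_left)
  then show ?thesis using L_pos by (simp add: field_simps)
qed

text \<open>For \<open>\<beta> \<noteq> 0\<close> successors and predecessors give opposite weak
  inequalities for the sines at \<open>upper f\<close> and \<open>lower f\<close>; without a
  representative of \<open>c\<close> in between, both sines would have the same strict sign.\<close>

lemma supp_imp_good:
  assumes f: "sepseq (Suc k) f" and "supp F" and fF: "\<And>j. j < Suc k \<Longrightarrow> f j \<in> F"
  shows "\<exists>z. good_at z f"
proof (rule ccontr)
  assume bad: "\<not> ?thesis"
  obtain p i0 where form: "trig_form k (pi * c / L) p" and nonneg: "\<And>i. 0 \<le> p (angle i)"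
    and zF: "\<And>i. i \<in> F \<Longrightarrow> p (angle i) = 0" and i0: "p (angle i0) \<noteq> 0"
    using assms(2) unfolding supp_def by blast
  obtain q \<beta> where q: "trig_poly k q" and
    p: "\<And>t. p t = q t + \<beta> * cos (real (Suc k) * t - pi * c / L)"
    using form by (elim trig_formE) blast
  show False
  proof (cases "\<beta> = 0")
    case False
    define K where "K = - 2 * (-4) ^ k * \<beta>"
    have K: "K \<noteq> 0" using False by (simp add: K_def)
    have up: "0 \<le> K * sin (pi * (upper f - c) / L)"
    proof -
      obtain w where w: "\<And>j. j < Suc k \<Longrightarrow> 0 < w j"
        and eq: "of_int 1 * (\<Sum>j<Suc k. w j * p (angle (f j + 1)))
          = - 2 * (-4) ^ k * \<beta> * sin ((\<Sum>j<Suc k. angle (f j) + angle (f j + 1)) / 2 - pi * c / L)"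
        by (rule alternating_weights[OF f _ q p, of 1]) (use zF fF in auto)
      have "0 \<le> (\<Sum>j<Suc k. w j * p (angle (f j + 1)))"
        using w nonneg by (intro sum_nonneg mult_nonneg_nonneg) (auto intro: less_imp_le)
      then show ?thesis using eq unfolding sum_angle upper_def K_def by simp
    qed
    have low: "K * sin (pi * (lower f - c) / L) \<le> 0"
    proof -
      obtain w where w: "\<And>j. j < Suc k \<Longrightarrow> 0 < w j"
        and eq: "of_int (-1) * (\<Sum>j<Suc k. w j * p (angle (f j + -1)))
          = - 2 * (-4) ^ k * \<beta> * sin ((\<Sum>j<Suc k. angle (f j) + angle (f j + -1)) / 2 - pi * c / L)"
        by (rule alternating_weights[OF f _ q p, of "-1"]) (use zF fF in auto)
      have "0 \<le> (\<Sum>j<Suc k. w j * p (angle (f j + -1)))"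
        using w nonneg by (intro sum_nonneg mult_nonneg_nonneg) (auto intro: less_imp_le)
      moreover have "K * sin (pi * (lower f - c) / L) = - (\<Sum>j<Suc k. w j * p (angle (f j + -1)))"
        using eq unfolding sum_angle lower_def K_def by (simp del: sum.lessThan_Suc)
      ultimately show ?thesis by linarith
    qed
    have "lower f \<le> upper f" unfolding lower_def upper_def
      by (intro sum_mono add_left_mono x_le) auto
    then have same: "0 < sin (pi * (lower f - c) / L) * sin (pi * (upper f - c) / L)"
      using bad by (intro sin_same_sign) (auto simp: good_at_def)
    have "0 < K * K" using K not_real_square_gt_zero by blast
    then have "0 < (K * K) * (sin (pi * (lower f - c) / L) * sin (pi * (upper f - c) / L))"
      using same by (rule mult_pos_pos)
    also have "\<dots> = (K * sin (pi * (lower f - c) / L)) * (K * sin (pi * (upper f - c) / L))"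
      by (simp only: mult.assoc mult.left_commute)
    finally have "0 < (K * sin (pi * (lower f - c) / L)) * (K * sin (pi * (upper f - c) / L))" .
    then show False using mult_nonpos_nonneg[OF low up] by linarith
  next
    case True
    \<comment> \<open>For \<open>\<beta> = 0\<close> a positively weighted sum of nonnegative values
      is 0, so zeros propagate to the successors and finally around the whole cycle.\<close>
    have "\<forall>j<Suc k. p (angle (f j + int m)) = 0" for m
    proof (induction m)
      case 0 then show ?case using zF fF by simp
    next
      case (Suc m)
      define g where "g j = f j + int m" for j
      have g: "sepseq (Suc k) g" using f by (simp add: sepseq_def g_def)
      obtain w where w: "\<And>j. j < Suc k \<Longrightarrow> 0 < w j"
        and eq: "of_int 1 * (\<Sum>j<Suc k. w j * p (angle (g j + 1)))
          = - 2 * (-4) ^ k * \<beta> * sin ((\<Sum>j<Suc k. angle (g j) + angle (g j + 1)) / 2 - pi * c / L)"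
        by (rule alternating_weights[OF g _ q p, of 1]) (use Suc in \<open>auto simp: g_def\<close>)
      have "(\<Sum>j<Suc k. w j * p (angle (g j + 1))) = 0" using eq True by simp
      moreover have "0 \<le> w j * p (angle (g j + 1))" if "j \<in> {..<Suc k}" for j
        using w[of j] nonneg[of "g j + 1"] that by simp
      ultimately have "w j * p (angle (g j + 1)) = 0" if "j < Suc k" for j
        using sum_nonneg_eq_0_iff[of "{..<Suc k}" "\<lambda>j. w j * p (angle (g j + 1))"] that by blast
      then have "p (angle (g j + 1)) = 0" if "j < Suc k" for j using w[OF that] that by force
      then show ?case by (simp add: g_def algebra_simps)
    qed
    from this[of "nat ((i0 - f 0) mod int n)"]
    have "p (angle (f 0 + (i0 - f 0) mod int n)) = 0" using n by simp
    then have "p (angle (f 0 + (i0 - f 0) mod int n + int n * ((i0 - f 0) div int n))) = 0"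
      by (simp only: form_angle_shift[OF form])
    then show False using i0 by (simp add: add.assoc)
  qed
qed

end

section \<open>Supporting functions with prescribed zeros\<close>

context moment_config
begin

text \<open>No configuration point lies strictly inside the gap or its translates, so at each of
  them both sines have weakly the same sign.\<close>

lemma sin_pair_nonneg:
  assumes "x e \<le> u" "u \<le> x (e + 1)" "x e \<le> v" "v \<le> x (e + 1)"
  shows "0 \<le> sin ((angle i - 2 * pi * u / L) / 2) * sin ((angle i - 2 * pi * v / L) / 2)"
proof -
  \<comment> \<open>\<open>r\<close> is the representative of \<open>i\<close> in the period that
    starts right after the gap.\<close>
  define r q where "r = e + 1 + (i - e - 1) mod int n" and "q = (i - e - 1) div int n"
  have i: "i = r + int n * q" unfolding r_def q_def by simp
  have "(i - e - 1) mod int n < int n" "0 \<le> (i - e - 1) mod int n" using n by simp_all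
  then have r: "e + 1 \<le> r" "r \<le> e + int n" unfolding r_def by linarith+
  have "\<exists>s\<ge>0. sin ((angle i - 2 * pi * y / L) / 2) = cos (pi * of_int q) * s"
    if "x e \<le> y" "y \<le> x (e + 1)" for y
  proof (intro exI conjI)
    have "y \<le> x r" "x r \<le> y + L"
      using that x_le[OF r(1)] x_le[OF r(2)] period[of e] by linarith+
    then show "0 \<le> sin (pi * (x r - y) / L)"
      using L_pos by (intro sin_ge_zero) (auto simp: divide_le_eq)
    have "(angle i - 2 * pi * y / L) / 2 = pi * (x r - y) / L + pi * of_int q"
      unfolding i angle_def x_shift using L_pos by (simp add: field_simps)
    then show "sin ((angle i - 2 * pi * y / L) / 2) = cos (pi * of_int q) * sin (pi * (x r - y) / L)"
      by (simp only: sin_shift_int)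
  qed
  from this[OF assms(1,2)] this[OF assms(3,4)] obtain s s' where
    s: "0 \<le> s" "sin ((angle i - 2 * pi * u / L) / 2) = cos (pi * of_int q) * s"
      "0 \<le> s'" "sin ((angle i - 2 * pi * v / L) / 2) = cos (pi * of_int q) * s'" by blast
  have "0 \<le> (cos (pi * of_int q) * cos (pi * of_int q)) * (s * s')"
    using s by (intro mult_nonneg_nonneg[OF zero_le_square] mult_nonneg_nonneg)
  then show ?thesis unfolding s by (simp only: mult.assoc mult.left_commute)
qed

text \<open>A period contains at most \<open>2 * k + 2\<close> zeros, fewer than its
  \<open>n\<close> configuration points.\<close>

lemma root_prod_nonzero: "\<exists>i. root_prod y (angle i) \<noteq> 0"
proof (rule ccontr)
  assume "\<not> ?thesis"
  then have "\<exists>j. j < 2 * Suc k \<and> (\<exists>z. y j = x i + L * of_int z)" for i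
    using root_prod_zeroE by metis
  then obtain h where h: "\<And>i. h i < 2 * Suc k" "\<And>i. \<exists>z. y (h i) = x i + L * of_int z"
    by metis
  have "inj_on h {0..<int n}"
  proof
    fix i i' assume ii: "i \<in> {0..<int n}" "i' \<in> {0..<int n}" "h i = h i'"
    obtain z where z: "y (h i) = x i + L * of_int z" using h(2) by blast
    obtain z' where z': "y (h i') = x i' + L * of_int z'" using h(2) by blast
    have "x (i + int n * z) = x (i' + int n * z')" using z z' ii(3) by (simp add: x_shift)
    then have "i + int n * z = i' + int n * z'" using mono strict_mono_eq by blast
    then have "(i + int n * z) mod int n = (i' + int n * z') mod int n" by simp
    then show "i = i'" using ii by simp
  qed
  then have "card {0..<int n} \<le> card {..<2 * Suc k}"
    using h(1) by (intro card_inj_on_le) auto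
  then show False using n by simp
qed

text \<open>Each pair of zeros coincides or stays within one gap, so its factor is nonnegative at
  all configuration points.\<close>

lemma supp_if_pairs:
  assumes pairs: "\<And>j. j < Suc k \<Longrightarrow> X j = Y j \<or>
      (\<exists>e. x e \<le> X j \<and> X j \<le> x (e + 1) \<and> x e \<le> Y j \<and> Y j \<le> x (e + 1))"
    and sum: "(\<Sum>j<Suc k. X j + Y j) = c + L * of_int z"
    and cover: "\<And>i. i \<in> F \<Longrightarrow> \<exists>j<Suc k. x i = X j \<or> x i = Y j"
  shows "supp F"
proof -
  define y where "y i = (if even i then X (i div 2) else Y (i div 2))" for i :: nat
  have y: "y (2 * j) = X j" "y (2 * j + 1) = Y j" for j by (simp_all add: y_def)
  have "(\<Sum>i<2 * Suc k. y i) = c + L * of_int z" unfolding sum_pairs y by (rule sum)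
  then have "trig_form k (pi * c / L) (root_prod y)" by (rule root_prod_form)
  moreover have "0 \<le> root_prod y (angle i)" for i
    unfolding root_prod_def prod_pairs y
  proof (intro prod_nonneg)
    fix j assume "j \<in> {..<Suc k}"
    then have "X j = Y j \<or>
      (\<exists>e. x e \<le> X j \<and> X j \<le> x (e + 1) \<and> x e \<le> Y j \<and> Y j \<le> x (e + 1))" using pairs by simp
    then show "0 \<le> sin ((angle i - 2 * pi * X j / L) / 2) * sin ((angle i - 2 * pi * Y j / L) / 2)"
      using sin_pair_nonneg by fastforce
  qed
  moreover have "root_prod y (angle i) = 0" if iF: "i \<in> F" for i
  proof -
    obtain j where j: "j < Suc k" "x i = X j \<or> x i = Y j" using cover[OF iF] by blast
    from j(2) show ?thesis
    proof
      assume "x i = X j"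
      then show ?thesis using j(1) by (intro root_prod_zero[of "2 * j"]) (simp_all add: y)
    next
      assume "x i = Y j"
      then show ?thesis using j(1) y(2)[of j] by (intro root_prod_zero[of "2 * j + 1"]) simp_all
    qed
  qed
  ultimately show ?thesis unfolding supp_def using root_prod_nonzero by blast
qed

text \<open>With at most \<open>k\<close> pairs, a free double zero makes up for the prescribed sum.\<close>

lemma supp_if_few_pairs:
  assumes "m \<le> k" and cover: "\<And>i. i \<in> F \<Longrightarrow> \<exists>j<m. i = a j \<or> i = a j + 1"
  shows "supp F"
proof -
  define S where "S = (\<Sum>j<k. if j < m then x (a j) + x (a j + 1) else 2 * x 0)"
  \<comment> \<open>Indices from \<open>m\<close> to \<open>k - 1\<close> are padded with double
    zeros at \<open>x 0\<close>; index \<open>k\<close> carries the free double zero.\<close>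
  define X where "X j = (if j < m then x (a j) else if j < k then x 0 else (c - S) / 2)" for j
  define Y where "Y j = (if j < m then x (a j + 1) else if j < k then x 0 else (c - S) / 2)" for j
  show ?thesis
  proof (rule supp_if_pairs)
    fix j assume "j < Suc k"
    show "X j = Y j \<or> (\<exists>e. x e \<le> X j \<and> X j \<le> x (e + 1) \<and> x e \<le> Y j \<and> Y j \<le> x (e + 1))"
    proof (cases "j < m")
      case True
      then show ?thesis by (intro disjI2 exI[of _ "a j"]) (simp add: X_def Y_def x_le)
    qed (simp add: X_def Y_def)
  next
    have "(\<Sum>j<k. X j + Y j) = S" unfolding S_def by (intro sum.cong) (auto simp: X_def Y_def)
    moreover have "X k = (c - S) / 2" "Y k = (c - S) / 2" using assms(1) by (simp_all add: X_def Y_def)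
    ultimately show "(\<Sum>j<Suc k. X j + Y j) = c + L * of_int 0"
      by (simp only: sum.lessThan_Suc) simp
  next
    fix i assume "i \<in> F"
    then obtain j where "j < m" "i = a j \<or> i = a j + 1" using cover by blast
    then show "\<exists>j<Suc k. x i = X j \<or> x i = Y j"
      using assms(1) by (intro exI[of _ j]) (auto simp: X_def Y_def)
  qed
qed

section \<open>Sliding zeros from one cover to another\<close>

lemma discrete_crossing:
  fixes T :: "nat \<Rightarrow> real"
  assumes "T 0 \<le> C" "C \<le> T (Suc m)"
  obtains t where "t < Suc m" "T t \<le> C" "C \<le> T (Suc t)"
proof -
  have "\<exists>t<Suc m. T t \<le> C \<and> C \<le> T (Suc t)" using assms
  proof (induction m)
    case (Suc m)
    show ?case
    proof (cases "C \<le> T (Suc m)")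
      case True
      then show ?thesis using Suc by (meson less_SucI)
    next
      case False
      then show ?thesis using Suc by (intro exI[of _ "Suc m"]) auto
    qed
  qed auto
  then show thesis using that by blast
qed

text \<open>The pairs \<open>b j - 1, b j\<close> are replaced by \<open>a j, a j + 1\<close> from left to right, moving one zero
  at a time, until the sum of all zeros has the prescribed value. All of \<open>F\<close> stays covered.\<close>

lemma supp_if_two_covers:
  assumes ab: "\<And>j. j < Suc k \<Longrightarrow> a j \<le> b j \<and> b j \<le> a j + 1"
    and a: "sepseq (Suc k) a"
    and ca: "\<And>i. i \<in> F \<Longrightarrow> \<exists>j<Suc k. i = a j \<or> i = a j + 1"
    and cb: "\<And>i. i \<in> F \<Longrightarrow> \<exists>j<Suc k. i = b j - 1 \<or> i = b j"
    and C: "lower b \<le> c + L * of_int z" "c + L * of_int z \<le> upper a"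
  shows "supp F"
proof -
  define T where "T t = (\<Sum>j<Suc k. if j < t then x (a j) + x (a j + 1) else x (b j) + x (b j - 1))" for t
  have "T 0 \<le> c + L * of_int z" using C(1) by (simp add: T_def lower_def)
  moreover have "upper a = T (Suc k)" unfolding T_def upper_def by (intro sum.cong) auto
  ultimately obtain t where t: "t < Suc k" "T t \<le> c + L * of_int z" "c + L * of_int z \<le> T (Suc t)"
    using discrete_crossing[of T _ k] C(2) by auto
  define R where "R = (\<Sum>j\<in>{..<Suc k} - {t}. if j < t then x (a j) + x (a j + 1) else x (b j) + x (b j - 1))"
  have T1: "T t = x (b t) + x (b t - 1) + R"
    unfolding T_def R_def using t(1) by (subst sum.remove[of _ t]) auto
  have T2: "T (Suc t) = x (a t) + x (a t + 1) + R"
    unfolding T_def R_def using t(1) by (subst sum.remove[of _ t]) (auto intro!: sum.cong simp: less_Suc_eq)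
  \<comment> \<open>In pair \<open>t\<close> the zero at \<open>x (a t)\<close> is kept and the
    other one is solved for. It lies in the gap right of \<open>a t\<close> or, only if
    \<open>b t = a t\<close>, in the gap left of it.\<close>
  define r where "r = c + L * of_int z - R - x (a t)"
  have r: "x (b t) + x (b t - 1) - x (a t) \<le> r" "r \<le> x (a t + 1)"
    using t T1 T2 by (simp_all add: r_def)
  have cases: "b t = a t \<or> b t = a t + 1" using ab[OF t(1)] by linarith
  define X where "X j = (if j \<le> t then x (a j) else x (b j))" for j
  define Y where "Y j = (if j < t then x (a j + 1) else if j = t then r else x (b j - 1))" for j
  show ?thesis
  proof (rule supp_if_pairs)
    fix j assume "j < Suc k"
    consider "j < t" | "j = t" | "t < j" by linarith
    then have "\<exists>e. x e \<le> X j \<and> X j \<le> x (e + 1) \<and> x e \<le> Y j \<and> Y j \<le> x (e + 1)"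
    proof cases
      case 1
      then show ?thesis by (intro exI[of _ "a j"]) (simp add: X_def Y_def x_le)
    next
      case 2
      show ?thesis
      proof (cases "x (a t) \<le> r")
        case True
        then show ?thesis using 2 r by (intro exI[of _ "a t"]) (simp add: X_def Y_def x_le)
      next
        case False
        have "b t = a t" using False cases r x_le[of "a t" "a t + 1"] by auto
        then show ?thesis using 2 r False by (intro exI[of _ "a t - 1"]) (simp add: X_def Y_def x_le)
      qed
    next
      case 3
      then show ?thesis by (intro exI[of _ "b j - 1"]) (simp add: X_def Y_def x_le)
    qed
    then show "X j = Y j \<or> (\<exists>e. x e \<le> X j \<and> X j \<le> x (e + 1) \<and> x e \<le> Y j \<and> Y j \<le> x (e + 1))" ..
  next
    have "(\<Sum>j<Suc k. X j + Y j) = X t + Y t + (\<Sum>j\<in>{..<Suc k} - {t}. X j + Y j)"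
      using t(1) by (subst sum.remove[of _ t]) auto
    also have "(\<Sum>j\<in>{..<Suc k} - {t}. X j + Y j) = R"
      unfolding R_def by (intro sum.cong) (auto simp: X_def Y_def)
    finally show "(\<Sum>j<Suc k. X j + Y j) = c + L * of_int z" by (simp add: X_def Y_def r_def)
  next
    fix i assume iF: "i \<in> F"
    obtain J where J: "J < Suc k" "i = a J \<or> i = a J + 1" using ca[OF iF] by blast
    obtain J' where J': "J' < Suc k" "i = b J' - 1 \<or> i = b J'" using cb[OF iF] by blast
    \<comment> \<open>Hence the \<open>a\<close>-pair of \<open>i\<close> is already switched on, or
      its \<open>b\<close>-pair is not yet switched off, or both have index
      \<open>t\<close>.\<close>
    have "J \<le> J'"
    proof (rule ccontr)
      assume "\<not> J \<le> J'"
      then have "a J' + 2 \<le> a J" using sepseq_less[OF a] J(1) by simp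
      then show False using ab[OF J'(1)] J(2) J'(2) by auto
    qed
    then consider "J < t" | "t < J'" | "J = t" "J' = t" by linarith
    then show "\<exists>j<Suc k. x i = X j \<or> x i = Y j"
    proof cases
      case 1
      then show ?thesis using J by (intro exI[of _ J]) (auto simp: X_def Y_def)
    next
      case 2
      then show ?thesis using J' by (intro exI[of _ J']) (auto simp: X_def Y_def)
    next
      case 3
      from cases show ?thesis
      proof
        assume "b t = a t"
        then have "i = a t" using 3 J(2) J'(2) by auto
        then show ?thesis using t(1) by (intro exI[of _ t]) (auto simp: X_def)
      next
        assume "b t = a t + 1"
        then have "r = x (a t + 1)" using r by simp
        then show ?thesis using t(1) J(2) 3 by (intro exI[of _ t]) (auto simp: X_def Y_def)
      qed
    qed
  qed
qed

text \<open>The gap bounds keep the representatives for \<open>f\<close> and \<open>g\<close> less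
  than \<open>L\<close> apart. One estimate may attain \<open>L\<close> itself, and there
  \<open>generic\<close> gives strictness.\<close>

lemma good_at_step:
  assumes "good_at z f" "good_at z' g" and t: "t < Suc k"
    and g: "\<And>j. j < Suc k \<Longrightarrow> j \<noteq> t \<Longrightarrow> g j = f j" "g t = f t - 1"
  shows "z' = z"
proof -
  have gap2: "x (i + 1) - x (i - 1) \<le> 2" for i
    using gap[of i] gap[of "i - 1"] by simp
  have "f t - 1 + 1 = f t" "f t - 2 + 1 = f t - 1" by simp_all
  then have four: "x (f t) + x (f t + 1) - x (f t - 1) - x (f t - 2) \<le> 4"
    using gap[of "f t"] gap[of "f t - 1"] gap[of "f t - 2"] by (simp only:)
  have cardt: "real (card ({..<Suc k} - {t})) = real k" using t by simp
  have "upper f - lower g = (x (f t) + x (f t + 1) - x (f t - 1) - x (f t - 2))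
      + (\<Sum>j\<in>{..<Suc k} - {t}. x (f j + 1) - x (f j - 1))"
    unfolding upper_def lower_def sum_subtractf[symmetric]
    using t g by (subst sum.remove[of _ t]) (auto intro!: sum.cong)
  also have "\<dots> \<le> 4 + (\<Sum>j\<in>{..<Suc k} - {t}. 2)"
    using four gap2 by (intro add_mono sum_mono) auto
  also have "\<dots> \<le> L" using L cardt by simp
  finally have 1: "upper f - lower g \<le> L" .
  have "lower g \<noteq> c + L * of_int z'" 
  proof -
    define h where "h i = (if even i then g (i div 2) else g (i div 2) - 1)" for i :: nat
    have "lower g = (\<Sum>i<2 * Suc k. x (h i))"
      unfolding sum_pairs lower_def by (simp add: h_def)
    then show ?thesis using generic by simp
  qed
  then have "lower g < c + L * of_int z'" using assms(2) by (simp add: good_at_def)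
  then have "L * of_int z < L * of_int (z' + 1)"
    using assms(1) 1 by (simp add: good_at_def algebra_simps)
  then have le: "z \<le> z'" using L_pos by simp
  \<comment> \<open>At \<open>t\<close> the terms cancel: \<open>g t\<close> with its successor is
    the same pair as \<open>f t\<close> with its predecessor.\<close>
  have "upper g - lower f = (\<Sum>j\<in>{..<Suc k} - {t}. x (f j + 1) - x (f j - 1))"
    unfolding upper_def lower_def sum_subtractf[symmetric]
    using t g by (subst sum.remove[of _ t]) (auto intro!: sum.cong)
  also have "\<dots> \<le> (\<Sum>j\<in>{..<Suc k} - {t}. 2)" using gap2 by (intro sum_mono) simp
  also have "\<dots> < L" using L cardt by simp
  finally have "upper g - lower f < L" .
  then have "L * of_int z' < L * of_int (z + 1)"
    using assms(1,2) by (simp add: good_at_def algebra_simps)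
  then have "z' \<le> z" using L_pos by simp
  with le show ?thesis by simp
qed

text \<open>The length \<open>m\<close> of the greedy selections decides: up to \<open>k\<close>
  pairs leave a free double zero, \<open>k + 2\<close> or more are excluded by
  \<open>no_long\<close>, and for \<open>k + 1\<close> both selections are joined step by
  step.\<close>

lemma supp_if_all_good:
  assumes F: "F \<subseteq> {g<..<g + int n}"
    and good: "\<And>f. sepseq (Suc k) f \<Longrightarrow> (\<And>j. j < Suc k \<Longrightarrow> f j \<in> F) \<Longrightarrow> \<exists>z. good_at z f"
    and no_long: "\<And>f. sepseq (k + 2) f \<Longrightarrow> \<exists>j<k + 2. f j \<notin> F"
  shows "supp F"
proof -
  have "finite F" using F finite_subset by blast
  from greedy_pairs[OF this] obtain m a b where
    ab: "\<forall>j<m. a j \<in> F \<and> b j \<in> F \<and> a j \<le> b j \<and> b j \<le> a j + 1"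
    and sep: "\<forall>j. Suc j < m \<longrightarrow> a j + 2 \<le> a (Suc j) \<and> b j + 2 \<le> b (Suc j)"
    and ca: "\<forall>i\<in>F. \<exists>j<m. i = a j \<or> i = a j + 1"
    and cb: "\<forall>i\<in>F. \<exists>j<m. i = b j - 1 \<or> i = b j"
    by (elim exE conjE)
  \<comment> \<open>\<open>F\<close> avoids \<open>g\<close> and its translate, so nonadjacency
    across the seam is automatic.\<close>
  have sepF: "sepseq l f" if "0 < l" "\<And>j. Suc j < l \<Longrightarrow> f j + 2 \<le> f (Suc j)" "\<And>j. j < l \<Longrightarrow> f j \<in> F" for l f
  proof -
    have "f (l - 1) \<in> F" "f 0 \<in> F" using that(1) by (simp_all add: that(3))
    then have "f (l - 1) \<in> {g<..<g + int n}" "f 0 \<in> {g<..<g + int n}" using F by blast+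
    then have "f (l - 1) + 2 \<le> f 0 + int n" by simp
    then show ?thesis using that unfolding sepseq_def by blast
  qed
  consider "m \<le> k" | "m = Suc k" | "k + 2 \<le> m" by linarith
  then show ?thesis
  proof cases
    case 1
    then show ?thesis using supp_if_few_pairs ca by blast
  next
    case 3
    then have "sepseq (k + 2) a" using sep ab by (intro sepF) auto
    then show ?thesis using no_long ab 3 by (meson less_le_trans)
  next
    case 2
    \<comment> \<open>This leads from \<open>b\<close> at \<open>t = 0\<close> to \<open>a\<close>
      at \<open>t = Suc k\<close>; each step changes one entry by 0 or -1, so
      \<open>good_at_step\<close> preserves \<open>z\<close>.\<close>
    define f where "f t j = (if j < t then a j else b j)" for t j
    have good_f: "\<exists>z. good_at z (f t)" for t
    proof (rule good)
      show fF: "f t j \<in> F" if "j < Suc k" for j using ab 2 that by (simp add: f_def)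
      show "sepseq (Suc k) (f t)"
      proof (rule sepF)
        fix j assume j: "Suc j < Suc k"
        then have "a j + 2 \<le> a (Suc j)" "b j + 2 \<le> b (Suc j)" "a (Suc j) \<le> b (Suc j)"
          using sep ab 2 by auto
        then show "f t j + 2 \<le> f t (Suc j)" by (auto simp: f_def)
      qed (use fF in auto)
    qed
    obtain z where z: "good_at z (f 0)" using good_f by blast
    have chain: "good_at z (f t)" if "t \<le> Suc k" for t
      using that
    proof (induction t)
      case (Suc t)
      then have IH: "good_at z (f t)" by simp
      have "a t = b t \<or> a t = b t - 1" using ab 2 Suc.prems by (metis Suc_le_lessD add_diff_cancel zle_add1_eq_le dual_order.antisym linorder_not_le)
      then show ?case
      proof
        assume "a t = b t"
        then have "f (Suc t) = f t" by (auto simp: f_def fun_eq_iff less_Suc_eq)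
        then show ?thesis using IH by simp
      next
        assume at: "a t = b t - 1"
        obtain z' where "good_at z' (f (Suc t))" using good_f by blast
        moreover from this have "z' = z"
          by (rule good_at_step[OF IH, of _ _ t]) (use Suc.prems at in \<open>auto simp: f_def\<close>)
        ultimately show ?thesis by simp
      qed
    qed (rule z)
    have "lower b \<le> c + L * of_int z" using z by (simp add: good_at_def f_def lower_def)
    moreover have "upper a = upper (f (Suc k))" unfolding upper_def by (simp add: f_def)
    then have "c + L * of_int z \<le> upper a" using chain[of "Suc k"] by (simp add: good_at_def)
    moreover have "sepseq (Suc k) a" using sep ab 2 by (intro sepF) auto
    ultimately show ?thesis
      using ab ca cb 2 by (intro supp_if_two_covers[of a b]) auto
  qed
qed

lemma supp_if_card_le:
  assumes "finite F" "card F \<le> k"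
  shows "supp F"
proof -
  obtain h where "bij_betw h {0..<card F} F" using ex_bij_betw_nat_finite[OF assms(1)] by blast
  then have "\<exists>j<card F. i = h j \<or> i = h j + 1" if "i \<in> F" for i
    using that unfolding bij_betw_def by (metis atLeastLessThan_iff imageE)
  then show ?thesis by (rule supp_if_few_pairs[OF assms(2)])
qed

end

section \<open>Missing faces\<close>

context moment_config
begin

lemma sepseq_delete:
  assumes "sepseq (k + 2) f" "i < k + 2"
  shows "sepseq (Suc k) (\<lambda>j. f (if j < i then j else Suc j))"
proof -
  define d where "d j = (if j < i then j else Suc j)" for j
  have d: "d j < d (Suc j)" "d 0 < d k" "j < Suc k \<Longrightarrow> d j < k + 2" for j
    using k assms(2) by (auto simp: d_def)
  have "f (d j) + 2 \<le> f (d (Suc j))" if "Suc j < Suc k" for j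
    using sepseq_less[OF assms(1) d(1) d(3)] that by simp
  moreover have "f (d k) + 2 \<le> f (d 0) + int n"
    using sepseq_wrap[OF assms(1) d(2) d(3)] by simp
  ultimately show ?thesis unfolding sepseq_def d_def[symmetric] by simp
qed

end

context moment_polytope
begin

text \<open>Indices of the same point are congruent modulo \<open>n\<close>, where a trigonometric
  form takes equal values; so \<open>supp\<close> depends only on the set of points.\<close>

lemma supp_closure:
  assumes "supp F"
  shows "supp {i. pt i \<in> pt ` F}"
proof -
  obtain p where p: "trig_form k (pi * c / L) p" "\<forall>i. 0 \<le> p (angle i)"
    "\<forall>i\<in>F. p (angle i) = 0" "\<exists>i. p (angle i) \<noteq> 0"
    using assms unfolding supp_def by blast
  have "p (angle i) = 0" if "pt i \<in> pt ` F" for i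
  proof -
    from \<open>pt i \<in> pt ` F\<close> obtain i' where i': "i' \<in> F" "pt i = pt i'" by blast
    then have "pt (i mod int n) = pt (i' mod int n)" by (simp add: pt_mod)
    then have "i mod int n = i' mod int n"
      using n by (intro inj_onD[OF pt_inj]) auto
    then have "i = i' + int n * (i div int n - i' div int n)"
      using mult_div_mod_eq[of "int n" i] mult_div_mod_eq[of "int n" i']
      unfolding right_diff_distrib by linarith
    then have "p (angle i) = p (angle i')" using form_angle_shift[OF p(1)] by metis
    then show ?thesis using p(3) i'(1) by simp
  qed
  then show ?thesis using p unfolding supp_def by blast
qed

lemma boundary_iff_supp:
  "pt ` F \<in> boundary_complex P \<longleftrightarrow> supp F"
proof
  assume "pt ` F \<in> boundary_complex P"
  then have "supp {i. pt i \<in> pt ` F}" using boundary_imp_supp by blast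
  then show "supp F" unfolding supp_def by blast
next
  assume "supp F"
  then have "supp {i. pt i \<in> pt ` F}" by (rule supp_closure)
  then show "pt ` F \<in> boundary_complex P" using pt_in_V by (intro supp_imp_boundary) auto
qed

lemma small_in_boundary:
  assumes "T \<subseteq> V" "card T \<le> k"
  shows "T \<in> boundary_complex P"
proof -
  obtain J where J: "J \<subseteq> {0..<int n}" "inj_on pt J" "T = pt ` J"
    using assms(1) unfolding V_def by (auto simp: subset_image_inj)
  have "finite J" using J(1) finite_subset by blast
  moreover have "card J \<le> k" using assms(2) J by (simp add: card_image)
  ultimately show ?thesis using supp_if_card_le boundary_iff_supp J(3) by blast
qed

lemma vertices_P: "vertices P = V"
proof
  show "vertices P \<subseteq> V"
    unfolding vertices_def P_def using extreme_point_of_convex_hull by blast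
  show "V \<subseteq> vertices P"
  proof
    fix v assume "v \<in> V"
    then have "{v} \<in> boundary_complex P" using k by (intro small_in_boundary) auto
    then obtain F where "{v} = vertices F" "F face_of P" unfolding boundary_complex_def by blast
    then show "v \<in> vertices P"
      unfolding vertices_def using extreme_point_of_face by blast
  qed
qed

lemma neighborly_P: "neighborly P"
  unfolding neighborly_def k_neighborly_def
proof (intro allI impI, elim conjE)
  fix S assume S: "S \<subseteq> vertices P" "card S = nat (aff_dim P) div 2"
  then have "S \<in> boundary_complex P"
    unfolding vertices_P by (intro small_in_boundary) (simp_all add: aff_dim_P)
  then show "\<exists>F. F face_of P \<and> vertices F = S" unfolding boundary_complex_def by blast
qed

text \<open>Faces of all small sets force at least \<open>k + 1\<close> elements. With more, all
  \<open>(k + 1)\<close>-subsets would be faces, and \<open>supp_if_all_good\<close> would make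
  \<open>M\<close> itself a face.\<close>

lemma missing_face_dim:
  assumes no_long: "\<And>f. sepseq (k + 2) f \<Longrightarrow>
      \<exists>i<k + 2. \<not> (\<exists>z. good_at z (\<lambda>j. f (if j < i then j else Suc j)))"
    and M: "missing_face P M"
  shows "face_dim M = int k"
proof -
  have MV: "M \<subseteq> V" and Mb: "M \<notin> boundary_complex P"
    and Msub: "\<And>T. T \<subset> M \<Longrightarrow> T \<in> boundary_complex P"
    using M unfolding missing_face_def vertices_P by blast+
  have "finite M" using MV finite_V finite_subset by blast
  have "Suc k \<le> card M" using small_in_boundary[OF MV] Mb by fastforce
  moreover have "\<not> Suc k < card M"
  proof
    assume big: "Suc k < card M"
    have good: "\<exists>z. good_at z f"
      if f: "sepseq (Suc k) f" and fM: "\<And>j. j < Suc k \<Longrightarrow> pt (f j) \<in> M" for f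
    proof -
      have "card (pt ` f ` {..<Suc k}) \<le> Suc k"
        using card_image_le[of "{..<Suc k}" "pt \<circ> f"] by (simp add: image_comp)
      then have "pt ` f ` {..<Suc k} \<noteq> M" using big by auto
      then have "pt ` f ` {..<Suc k} \<subset> M" using fM by blast
      then have "supp (f ` {..<Suc k})" using Msub boundary_iff_supp by blast
      then show ?thesis using supp_imp_good[OF f] by blast
    qed
    have no_long_M: "\<exists>j<k + 2. pt (f j) \<notin> M" if f: "sepseq (k + 2) f" for f
    proof (rule ccontr)
      assume "\<not> ?thesis"
      then have fM: "pt (f j) \<in> M" if "j < k + 2" for j using that by blast
      obtain i where i: "i < k + 2" "\<not> (\<exists>z. good_at z (\<lambda>j. f (if j < i then j else Suc j)))"
        using no_long[OF f] by blast
      have "\<exists>z. good_at z (\<lambda>j. f (if j < i then j else Suc j))"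
        by (rule good[OF sepseq_delete[OF f i(1)]]) (simp add: fM)
      then show False using i(2) by blast
    qed
    \<comment> \<open>The even indices up to \<open>2 * k + 2\<close> are separated because
      \<open>n \<ge> 2 * k + 4\<close>; so some vertex lies outside \<open>M\<close>, and the cycle
      can be cut there.\<close>
    have "sepseq (k + 2) (\<lambda>j. 2 * int j)" using n by (simp add: sepseq_def)
    then obtain g where g: "pt g \<notin> M" using no_long_M by blast
    define F where "F = {i \<in> {g<..<g + int n}. pt i \<in> M}"
    have "supp F"
    proof (rule supp_if_all_good)
      show "F \<subseteq> {g<..<g + int n}" by (auto simp: F_def)
      show "\<exists>z. good_at z f" if "sepseq (Suc k) f" "\<And>j. j < Suc k \<Longrightarrow> f j \<in> F" for f
        using that by (intro good) (auto simp: F_def)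
      show "\<exists>j<k + 2. f j \<notin> F" if "sepseq (k + 2) f" for f
        using no_long_M[OF that] by (auto simp: F_def)
    qed
    moreover have "pt ` F = M"
    proof
      show "pt ` F \<subseteq> M" by (auto simp: F_def)
      show "M \<subseteq> pt ` F"
      proof
        fix v assume "v \<in> M"
        then obtain i where i: "g \<le> i" "i < g + int n" "v = pt i" using MV window_rep by blast
        then have "i \<noteq> g" using g \<open>v \<in> M\<close> by blast
        then have "i \<in> F" using i \<open>v \<in> M\<close> by (simp add: F_def)
        then show "v \<in> pt ` F" using i(3) by blast
      qed
    qed
    ultimately show False using Mb boundary_iff_supp by blast
  qed
  ultimately show ?thesis by (simp add: face_dim_def)
qed

end

text \<open>Reduces the theorem to a combinatorial condition on the configuration. The curve is
  chosen only here, since its phase depends on \<open>c\<close> and \<open>L\<close>.\<close>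

lemma (in moment_config) polytope_exists:
  assumes "DIM('a::euclidean_space) = 2 * k + 1"
    and "\<And>f. sepseq (k + 2) f \<Longrightarrow>
      \<exists>i<k + 2. \<not> (\<exists>z. good_at z (\<lambda>j. f (if j < i then j else Suc j)))"
  shows "\<exists>P :: 'a set. d_polytope (2 * k + 1) P \<and> simplicial_polytope P \<and> neighborly P
           \<and> card (vertices P) = n
           \<and> (\<forall>M. missing_face P M \<longrightarrow> face_dim M = int k)"
proof -
  obtain \<phi> :: "real \<Rightarrow> 'a" where
    "\<And>p. trig_form k (pi * c / L) p \<longleftrightarrow> (\<exists>a d. \<forall>t. p t = a \<bullet> \<phi> t - d)"
    using trig_form_embedding[OF assms(1)] by blast
  then interpret moment_polytope k n L c x \<phi> using assms(1) by unfold_locales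
  show ?thesis
    unfolding d_polytope_def
    using polytope_P aff_dim_P simplicial_P neighborly_P vertices_P card_V missing_face_dim[OF assms(2)]
    by (intro exI[of _ P]) auto
qed

lemma strict_mono_int_step:
  fixes x :: "int \<Rightarrow> real"
  assumes "\<And>i. x i < x (i + 1)"
  shows "strict_mono x"
proof (rule strict_monoI)
  fix i j :: int assume "i < j"
  then show "x i < x j"
    by (induction rule: int_gr_induct) (use assms in \<open>auto intro: less_trans\<close>)
qed

lemma sum_delete:
  fixes g :: "nat \<Rightarrow> 'b::ab_group_add"
  assumes "i \<le> m"
  shows "(\<Sum>j<m. g (if j < i then j else Suc j)) = (\<Sum>j<Suc m. g j) - g i"
  using assms
proof (induction m)
  case (Suc m)
  show ?case
  proof (cases "i = Suc m")
    case True
    then show ?thesis by (auto intro!: sum.cong)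
  next
    case False
    then show ?thesis using Suc by (simp add: algebra_simps)
  qed
qed simp

section \<open>Equally spaced points\<close>

text \<open>An integer sum never equals a half-integer plus a multiple of \<open>n\<close>, so
  \<open>c = 1/2\<close> is generic.\<close>

lemma uniform_config:
  assumes "1 \<le> k" "2 * k + 4 \<le> n"
  shows "moment_config k n (real n) (1/2) real_of_int"
proof
  fix f :: "nat \<Rightarrow> int" and z :: int
  show "(\<Sum>j<2 * Suc k. real_of_int (f j)) \<noteq> 1/2 + real n * of_int z"
  proof
    assume "(\<Sum>j<2 * Suc k. real_of_int (f j)) = 1/2 + real n * of_int z"
    then have "real_of_int (2 * (\<Sum>j<2 * Suc k. f j)) = real_of_int (1 + 2 * (int n * z))" by simp
    then have "2 * (\<Sum>j<2 * Suc k. f j) = 1 + 2 * (int n * z)" by (simp only: of_int_eq_iff)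
    then show False by presburger
  qed
qed (use assms in \<open>auto simp: strict_mono_def\<close>)

text \<open>Omitting \<open>f i\<close> forces \<open>2 * (\<sigma> - f i)\<close> into a window
  around \<open>n * z i\<close>. With \<open>k + 1 = 2 * h\<close>, members \<open>h\<close> steps
  apart either way around the cycle need different windows, and the resulting inequalities for
  \<open>z\<close> are contradictory.\<close>

lemma uniform_no_long:
  assumes "odd k" "1 \<le> k" "2 * k + 4 \<le> n"
    and f: "moment_config.sepseq n (k + 2) f"
  shows "\<exists>i<k + 2. \<not> (\<exists>z. moment_config.good_at k (real n) (1/2) real_of_int z
            (\<lambda>j. f (if j < i then j else Suc j)))"
proof (rule ccontr)
  interpret moment_config k n "real n" "1/2" real_of_int
    using assms by (intro uniform_config)
  assume "\<not> ?thesis"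
  then have "\<forall>i. \<exists>z. i < k + 2 \<longrightarrow> good_at z (\<lambda>j. f (if j < i then j else Suc j))" by blast
  then obtain z where z: "\<And>i. i < k + 2 \<Longrightarrow> good_at (z i) (\<lambda>j. f (if j < i then j else Suc j))"
    by metis
  define \<sigma> where "\<sigma> = (\<Sum>j<Suc (Suc k). f j)"
  have win: "2 * (\<sigma> - f i) - int (Suc k) \<le> int n * z i"
    "int n * z i + 1 \<le> 2 * (\<sigma> - f i) + int (Suc k)" if "i < k + 2" for i
  proof -
    define g where "g j = f (if j < i then j else Suc j)" for j
    have g: "(\<Sum>j<Suc k. g j) = \<sigma> - f i"
      unfolding g_def \<sigma>_def using that by (intro sum_delete) simp
    have "lower g = real_of_int (2 * (\<sigma> - f i) - int (Suc k))"
      unfolding lower_def g[symmetric] by (simp add: sum_subtractf sum.distrib sum_distrib_left del: sum.lessThan_Suc)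
    moreover have "upper g = real_of_int (2 * (\<sigma> - f i) + int (Suc k))"
      unfolding upper_def g[symmetric] by (simp add: sum.distrib sum_distrib_left del: sum.lessThan_Suc)
    ultimately have "real_of_int (2 * (\<sigma> - f i) - int (Suc k)) \<le> 1/2 + real_of_int (int n * z i)"
      "1/2 + real_of_int (int n * z i) \<le> real_of_int (2 * (\<sigma> - f i) + int (Suc k))"
      using z[OF that] unfolding good_at_def g_def by simp_all
    then show "2 * (\<sigma> - f i) - int (Suc k) \<le> int n * z i"
      "int n * z i + 1 \<le> 2 * (\<sigma> - f i) + int (Suc k)" by linarith+
  qed
  obtain h where h: "k + 1 = 2 * h" using assms(1) by (metis evenE even_plus_one_iff)
  have h1: "1 \<le> h" using h by simp
  have dist: "f i + 2 * int d \<le> f (i + d)" if "i + d < k + 2" for i d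
    using that
  proof (induction d)
    case (Suc d)
    then show ?case using sepseq_less[OF f, of "i + d" "i + Suc d"] by simp
  qed simp
  \<comment> \<open>\<open>h\<close> steps move \<open>f\<close> by at least \<open>k + 1\<close>,
    so the doubled sum falls by more than the length of a window.\<close>
  have drop: "z (i + h) \<le> z i - 1" if "i + h < k + 2" for i
  proof -
    have "f i + int (k + 1) \<le> f (i + h)" using dist[OF that] h by simp
    then have "int n * z (i + h) < int n * z i"
      using win(1)[of i] win(2)[OF that] that by simp
    then show ?thesis using n by simp
  qed
  \<comment> \<open>The \<open>h\<close> steps from \<open>i + 1 + h\<close> across the seam to
    \<open>i\<close> also cover \<open>k + 1\<close>; the seam adds \<open>2 * n\<close> to doubled
    sums, and \<open>drop\<close> at \<open>Suc i\<close> takes back one of the two units.\<close>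
  have rise: "z i \<le> z (Suc i)" if "i < h" for i
  proof -
    have ih: "i + 1 + h < k + 2" using that h by simp
    have "f (i + 1 + h) + 2 * int (k + 1 - (i + 1 + h)) \<le> f (k + 1)"
      using dist[of "i + 1 + h" "k + 1 - (i + 1 + h)"] ih by simp
    moreover have "f 0 + 2 * int i \<le> f i" using dist[of 0 i] ih by simp
    moreover have "f (k + 1) + 2 \<le> f 0 + int n" using f unfolding sepseq_def by simp
    moreover have "int (k + 1 - (i + 1 + h)) = int h - 1 - int i" using h that by simp
    ultimately have "f (i + 1 + h) + int (k + 1) \<le> f i + int n" using h by simp
    then have "int n * z i < int n * (z (i + 1 + h) + 2)"
      using win(1)[OF ih] win(2)[of i] ih by (simp add: algebra_simps)
    then have "z i \<le> z (i + 1 + h) + 1" using n by simp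
    then show ?thesis using drop[of "Suc i"] ih by simp
  qed
  have "z 0 \<le> z i" if "i \<le> h" for i
    using that
  proof (induction i)
    case (Suc i)
    then show ?case using rise[of i] by simp
  qed simp
  then have "z 0 \<le> z h" by simp
  then show False using drop[of 0] h by simp
qed

section \<open>Nine equally spaced points, one of them replaced by a cluster\<close>

locale cluster =
  fixes n :: nat
  assumes n: "9 \<le> n"
begin

text \<open>In each period the first \<open>n - 8\<close> indices form the cluster at a multiple of
  9; the other eight take the positions 1 to 8 after it.\<close>

definition pos :: "int \<Rightarrow> int" where
  "pos i = 9 * (i div int n) + max 0 (i mod int n - int (n - 9))"

text \<open>Spreads the cluster over less than 1/100, which makes \<open>x\<close> strictly
  increasing.\<close>

definition off :: "int \<Rightarrow> real" where
  "off i = (if i mod int n \<le> int (n - 9) then of_int (i mod int n) / (100 * real n) else 0)"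

definition x :: "int \<Rightarrow> real" where "x i = of_int (pos i) + off i"

lemma succ_cases:
  obtains "(i + 1) div int n = i div int n" "(i + 1) mod int n = i mod int n + 1" "i mod int n + 1 < int n"
  | "(i + 1) div int n = i div int n + 1" "(i + 1) mod int n = 0" "i mod int n = int n - 1"
proof -
  define q r where "q = i div int n" and "r = i mod int n"
  have i: "i = int n * q + r" by (simp add: q_def r_def)
  have r: "0 \<le> r" "r < int n" using n by (simp_all add: r_def)
  consider "r + 1 < int n" | "r = int n - 1" using r by linarith
  then show thesis
  proof cases
    case 1
    have "(i + 1) div int n = q" "(i + 1) mod int n = r + 1"
      using i r 1 by (simp_all add: int_div_pos_eq int_mod_pos_eq)
    then show thesis using that(1) 1 unfolding q_def r_def by blast
  next
    case 2
    have "i + 1 = int n * (q + 1)" using i 2 by (simp add: algebra_simps)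
    then have "(i + 1) div int n = q + 1" "(i + 1) mod int n = 0" using n by simp_all
    then show thesis using 2 by (intro that(2)) (simp_all add: q_def r_def)
  qed
qed

lemma pos_succ: "pos i \<le> pos (i + 1)" "pos (i + 1) \<le> pos i + 1"
  and pos_stay: "pos (i + 1) = pos i \<Longrightarrow> pos i mod 9 = 0"
  by (rule succ_cases[of i]; use n in \<open>auto simp: pos_def max_def split: if_splits\<close>)+

lemma pos_mono: "i \<le> j \<Longrightarrow> pos i \<le> pos j"
  by (induction rule: int_ge_induct) (use pos_succ in \<open>auto intro: order.trans\<close>)

lemma pos_period: "pos (i + int n) = pos i + 9"
  using n by (simp add: pos_def)

lemma off_bounds: "0 \<le> off i" "off i \<le> 1/100"
proof -
  have "0 \<le> i mod int n" "i mod int n < int n" using n by simp_all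
  then have "0 \<le> real_of_int (i mod int n)" "real_of_int (i mod int n) \<le> real n" by linarith+
  then show "0 \<le> off i" "off i \<le> 1/100"
    using n by (auto simp: off_def field_simps)
qed

lemma x_step: "x i < x (i + 1)" "x (i + 1) \<le> x i + 1"
proof -
  have n0: "0 < real n" using n by simp
  have "0 \<le> i mod int n" using n by simp
  then have m0: "0 \<le> real_of_int (i mod int n)" by simp
  show "x i < x (i + 1)"
  proof (rule succ_cases[of i])
    assume a: "(i + 1) div int n = i div int n" "(i + 1) mod int n = i mod int n + 1" "i mod int n + 1 < int n"
    show ?thesis
    proof (cases "i mod int n + 1 \<le> int (n - 9)")
      case True
      then have "pos (i + 1) = pos i" using a by (simp add: pos_def)
      moreover have "off i < off (i + 1)" using a True n0 by (simp add: off_def divide_strict_right_mono)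
      ultimately show ?thesis by (simp add: x_def)
    next
      case False
      then have "pos (i + 1) = pos i + 1" using a by (simp add: pos_def max_def)
      then show ?thesis using off_bounds[of i] off_bounds[of "i + 1"] by (simp add: x_def)
    qed
  next
    assume a: "(i + 1) div int n = i div int n + 1" "(i + 1) mod int n = 0" "i mod int n = int n - 1"
    then have "pos (i + 1) = pos i + 1" using n by (simp add: pos_def max_def)
    then show ?thesis using off_bounds[of i] off_bounds[of "i + 1"] by (simp add: x_def)
  qed
  show "x (i + 1) \<le> x i + 1"
  proof (rule succ_cases[of i])
    assume a: "(i + 1) div int n = i div int n" "(i + 1) mod int n = i mod int n + 1" "i mod int n + 1 < int n"
    show ?thesis
    proof (cases "i mod int n + 1 \<le> int (n - 9)")
      case True
      then have "pos (i + 1) = pos i" using a by (simp add: pos_def)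
      then show ?thesis using off_bounds[of i] off_bounds[of "i + 1"] by (simp add: x_def)
    next
      case False
      then have "pos (i + 1) = pos i + 1" "off (i + 1) = 0" using a by (simp_all add: pos_def max_def off_def)
      then show ?thesis using off_bounds[of i] by (simp add: x_def)
    qed
  next
    assume a: "(i + 1) div int n = i div int n + 1" "(i + 1) mod int n = 0" "i mod int n = int n - 1"
    then have "pos (i + 1) = pos i + 1" "off (i + 1) = 0" using n by (simp_all add: pos_def max_def off_def)
    then show ?thesis using off_bounds[of i] by (simp add: x_def)
  qed
qed

text \<open>Six offsets add at most 6/100, less than 1/2, so comparisons with a half-integer are
  decided by the integer positions alone.\<close>

lemma sum_x_bounds:
  "of_int (\<Sum>j\<in>A. pos (f j)) \<le> (\<Sum>j\<in>A. x (f j))"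
  "(\<Sum>j\<in>A. x (f j)) \<le> of_int (\<Sum>j\<in>A. pos (f j)) + real (card A) / 100"
proof -
  have "(\<Sum>j\<in>A. x (f j)) = of_int (\<Sum>j\<in>A. pos (f j)) + (\<Sum>j\<in>A. off (f j))"
    by (simp add: x_def sum.distrib)
  moreover have "0 \<le> (\<Sum>j\<in>A. off (f j))" using off_bounds by (intro sum_nonneg) auto
  moreover have "(\<Sum>j\<in>A. off (f j)) \<le> real (card A) / 100"
    using sum_bounded_above[of A "\<lambda>j. off (f j)" "1/100"] off_bounds by simp
  ultimately show "of_int (\<Sum>j\<in>A. pos (f j)) \<le> (\<Sum>j\<in>A. x (f j))"
    "(\<Sum>j\<in>A. x (f j)) \<le> of_int (\<Sum>j\<in>A. pos (f j)) + real (card A) / 100" by linarith+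
qed

lemma cluster_config: "moment_config 2 n 9 (7/2) x"
proof
  show "strict_mono x" using x_step(1) by (rule strict_mono_int_step)
  show "x (i + int n) = x i + 9" for i using n by (simp add: x_def pos_def off_def)
  show "x (i + 1) - x i \<le> 1" for i using x_step(2)[of i] by simp
  fix f :: "nat \<Rightarrow> int" and z :: int
  show "(\<Sum>j<2 * Suc 2. x (f j)) \<noteq> 7/2 + 9 * of_int z"
  proof
    assume eq: "(\<Sum>j<2 * Suc 2. x (f j)) = 7/2 + 9 * of_int z"
    define s where "s = (\<Sum>j<2 * Suc 2. pos (f j))"
    have "of_int s \<le> 7/2 + 9 * real_of_int z" "7/2 + 9 * real_of_int z \<le> of_int s + 6/100"
      using sum_x_bounds[of f "{..<2 * Suc 2}", unfolded eq, folded s_def] by simp_all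
    then have "real_of_int s < real_of_int (4 + 9 * z)" "real_of_int (3 + 9 * z) < real_of_int s" by simp_all
    then show False by (simp only: of_int_less_iff)
  qed
qed (use n in simp_all)

text \<open>Rounding around \<open>c = 7/2\<close> turns goodness into a necessary condition on
  integers, which suffices for excluding sequences.\<close>

lemma good_at_pos:
  assumes "moment_config.good_at 2 9 (7/2) x z f"
  shows "(\<Sum>j<3. pos (f j) + pos (f j - 1)) \<le> 3 + 9 * z"
    and "4 + 9 * z \<le> (\<Sum>j<3. pos (f j) + pos (f j + 1))"
proof -
  interpret moment_config 2 n 9 "7/2" x by (rule cluster_config)
  define s t where "s = (\<Sum>j<3. pos (f j) + pos (f j - 1))" and "t = (\<Sum>j<3. pos (f j) + pos (f j + 1))"
  have "of_int s \<le> lower f"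
    using sum_x_bounds(1)[of f "{..<3}"] sum_x_bounds(1)[of "\<lambda>j. f j - 1" "{..<3}"]
    by (simp add: lower_def s_def sum.distrib numeral_3_eq_3)
  moreover have "upper f \<le> of_int t + 6/100"
    using sum_x_bounds(2)[of f "{..<3}"] sum_x_bounds(2)[of "\<lambda>j. f j + 1" "{..<3}"]
    by (simp add: upper_def t_def sum.distrib numeral_3_eq_3)
  moreover have "lower f \<le> 7/2 + 9 * of_int z" "7/2 + 9 * of_int z \<le> upper f"
    using assms unfolding good_at_def by simp_all
  ultimately have "real_of_int s < real_of_int (4 + 9 * z)" "real_of_int (3 + 9 * z) < real_of_int t"
    by simp_all
  then show "s \<le> 3 + 9 * z" "4 + 9 * z \<le> t" by (simp_all only: of_int_less_iff)
qed

end

text \<open>The position class of a point of the cluster configuration is the triple of the positions of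
  its predecessor, of itself and of its successor, where the whole cluster sits at positions
  divisible by 9.\<close>

definition classes :: "(int \<times> int \<times> int) list" where
  "classes = concat (map (\<lambda>r. if r mod 9 = 0
     then [(r - 1, r, r + 1), (r - 1, r, r), (r, r, r), (r, r, r + 1)]
     else [(r - 1, r, r + 1)]) [0..17])"

text \<open>Some \<open>z\<close> satisfies both inequalities of \<open>good_at_pos\<close> iff the
  largest one allowed by the second does; the division computes it and makes the condition
  executable.\<close>

fun good3 :: "int \<times> int \<times> int \<Rightarrow> int \<times> int \<times> int \<Rightarrow> int \<times> int \<times> int \<Rightarrow> bool" where
  "good3 (p, r, s) (p', r', s') (p'', r'', s'') \<longleftrightarrow>
     r + p + (r' + p') + (r'' + p'') \<le> 3 + 9 * ((r + s + (r' + s') + (r'' + s'') - 4) div 9)"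

text \<open>The weak form of nonadjacency that positions retain; \<open>m\<close> is 0 for
  consecutive members and 9 for the comparison with the first member across the seam.\<close>

fun apart :: "int \<Rightarrow> int \<times> int \<times> int \<Rightarrow> int \<times> int \<times> int \<Rightarrow> bool" where
  "apart m (p, r, s) (p', r', s') \<longleftrightarrow> s \<le> p' + m"

lemma good3I:
  assumes "r + p + (r' + p') + (r'' + p'') \<le> 3 + 9 * z" "4 + 9 * z \<le> r + s + (r' + s') + (r'' + s'')"
  shows "good3 (p, r, s) (p', r', s') (p'', r'', s'')"
proof -
  have "z \<le> (r + s + (r' + s') + (r'' + s'') - 4) div 9" using assms(2) by linarith
  then show ?thesis using assms(1) by simp
qed

lemma classesI:
  assumes "p \<le> r" "r \<le> p + 1" "r \<le> s" "s \<le> r + 1" "0 \<le> r" "r \<le> 17"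
    "r mod 9 \<noteq> 0 \<Longrightarrow> p = r - 1 \<and> s = r + 1"
  shows "(p, r, s) \<in> set classes"
proof -
  have "r \<in> set [0..17]" using assms by simp
  moreover have "(p = r - 1 \<or> p = r) \<and> (s = r \<or> s = r + 1)" using assms by linarith
  then have "(p, r, s) \<in> set (if r mod 9 = 0
     then [(r - 1, r, r + 1), (r - 1, r, r), (r, r, r), (r, r, r + 1)]
     else [(r - 1, r, r + 1)])"
    using assms(7) by auto
  ultimately show ?thesis unfolding classes_def set_concat set_map by blast
qed

text \<open>A finite search by evaluation: the innermost \<open>False\<close> says that no fourth
  class survives the filters. The first class is normalized to positions 0 to 8.\<close>

lemma classes_check:
  "list_all (\<lambda>a. list_all (\<lambda>b. list_all (\<lambda>c. list_all (\<lambda>d. False)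
       (filter (good3 b c) (filter (good3 a c) (filter (good3 a b) (filter (\<lambda>d. apart 9 d a) (filter (apart 0 c) classes))))))
       (filter (good3 a b) (filter (\<lambda>c. apart 9 c a) (filter (apart 0 b) classes))))
       (filter (apart 0 a) classes)) (filter (\<lambda>(p, r, s). r \<le> 8) classes)"
  by code_simp

section \<open>Transfer of the finite check to the cluster configuration\<close>

context cluster
begin

lemma cluster_no_long:
  assumes f: "moment_config.sepseq n 4 f"
  shows "\<exists>i<4. \<not> (\<exists>z. moment_config.good_at 2 9 (7/2) x z (\<lambda>j. f (if j < i then j else Suc j)))"
proof (rule ccontr)
  interpret moment_config 2 n 9 "7/2" x by (rule cluster_config)
  assume "\<not> ?thesis"
  then have good: "\<exists>z. good_at z (\<lambda>j. f (if j < i then j else Suc j))" if "i < 4" for i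
    using that by blast
  \<comment> \<open>Subtracting \<open>9 * u\<close> brings the first position into 0 to 8; the
    others then stay at most 17, the range covered by \<open>classes\<close>.\<close>
  define u where "u = pos (f 0) div 9"
  define p where "p j = pos (f j - 1) - 9 * u" for j
  define r where "r j = pos (f j) - 9 * u" for j
  define s where "s j = pos (f j + 1) - 9 * u" for j
  have prs: "p j \<le> r j" "r j \<le> p j + 1" "r j \<le> s j" "s j \<le> r j + 1" for j
    using pos_succ[of "f j - 1"] pos_succ[of "f j"] by (simp_all add: p_def r_def s_def)
  have strict: "p j = r j - 1 \<and> s j = r j + 1" if "r j mod 9 \<noteq> 0" for j
  proof -
    have m: "pos (f j) mod 9 \<noteq> 0"
    proof -
      have "pos (f j) = r j + 9 * u" by (simp add: r_def)
      then show ?thesis using that by simp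
    qed
    have "p j \<noteq> r j" using m pos_stay[of "f j - 1"] by (auto simp: p_def r_def)
    moreover have "s j \<noteq> r j" using m pos_stay[of "f j"] by (auto simp: s_def r_def)
    ultimately show ?thesis using prs[of j] by linarith
  qed
  have ap: "s i \<le> p j" if "i < j" "j < 4" for i j
    using pos_mono[of "f i + 1" "f j - 1"] sepseq_less[OF f that] by (simp add: s_def p_def)
  have "s 3 \<le> p 0 + 9"
    using pos_mono[of "f 3 + 1" "f 0 - 1 + int n"] pos_period[of "f 0 - 1"] sepseq_wrap[OF f, of 0 3]
    by (simp add: s_def p_def)
  moreover have "r 0 = pos (f 0) mod 9" by (simp add: r_def u_def minus_mult_div_eq_mod)
  then have r0: "0 \<le> r 0" "r 0 \<le> 8" by simp_all
  ultimately have range: "0 \<le> r j" "r j \<le> 17" "s j \<le> p 0 + 9" if "j < 4" for j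
  proof -
    have "j = 0 \<or> 0 < j" "j = 3 \<or> j < 3" using that by linarith+
    then show "0 \<le> r j" "r j \<le> 17" "s j \<le> p 0 + 9"
      using ap[of 0 j] ap[of j 3] prs[of 0] prs[of j] prs[of 3] r0 \<open>s 3 \<le> p 0 + 9\<close> that by auto
  qed
  define a where "a j = (p j, r j, s j)" for j
  have cls: "a j \<in> set classes" if "j < 4" for j
    unfolding a_def using prs[of j] range[OF that] strict[of j] by (intro classesI) auto
  have g3: "good3 (a (d 0)) (a (d 1)) (a (d 2))"
    if i: "i < 4" and d: "d = (\<lambda>j. if j < i then j else Suc j)" for i d
  proof -
    obtain z where "good_at z (\<lambda>j. f (d j))" using good[OF i] d by auto
    \<comment> \<open>Six positions are shifted by \<open>9 * u\<close> each, which shifts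
      \<open>z\<close> by \<open>6 * u\<close>.\<close>
    from good_at_pos[OF this] show ?thesis
      unfolding a_def by (intro good3I[where z = "z - 6 * u"])
        (simp_all add: p_def r_def s_def numeral_3_eq_3 algebra_simps numeral_2_eq_2)
  qed
  have g: "good3 (a 0) (a 1) (a 2)" "good3 (a 0) (a 1) (a 3)" "good3 (a 0) (a 2) (a 3)" "good3 (a 1) (a 2) (a 3)"
    using g3[of 3] g3[of 2] g3[of 1] g3[of 0] by (simp_all add: numeral_2_eq_2 numeral_3_eq_3)
  have ap': "apart 0 (a 0) (a 1)" "apart 0 (a 1) (a 2)" "apart 0 (a 2) (a 3)"
    "apart 9 (a 2) (a 0)" "apart 9 (a 3) (a 0)"
    using ap[of 0 1] ap[of 1 2] ap[of 2 3] range(3)[of 2] range(3)[of 3] by (simp_all add: a_def)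
  have A: "a 0 \<in> set (filter (\<lambda>(p, r, s). r \<le> 8) classes)"
    using cls[of 0] r0 by (simp add: a_def)
  have B: "a 1 \<in> set (filter (apart 0 (a 0)) classes)"
    using cls[of 1] ap' by simp
  have C: "a 2 \<in> set (filter (good3 (a 0) (a 1)) (filter (\<lambda>c. apart 9 c (a 0)) (filter (apart 0 (a 1)) classes)))"
    using cls[of 2] ap' g by simp
  have D: "a 3 \<in> set (filter (good3 (a 1) (a 2)) (filter (good3 (a 0) (a 2)) (filter (good3 (a 0) (a 1))
      (filter (\<lambda>d. apart 9 d (a 0)) (filter (apart 0 (a 2)) classes)))))"
    using cls[of 3] ap' g by simp
  have mem: "Q y" if "list_all Q ys" "y \<in> set ys" for Q and y :: "int \<times> int \<times> int" and ys
    using that by (simp add: list_all_iff)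
  show False by (rule mem[OF mem[OF mem[OF mem[OF classes_check A] B] C] D])
qed

end

theorem theorem6p2:
  fixes k n :: nat
  assumes dim: "DIM('a::euclidean_space) = 2 * k + 1"
    and kn: "(odd k \<and> k \<ge> 3 \<and> n \<ge> 2 * k + 4) \<or> (k = 2 \<and> n \<ge> 9)"
  shows "\<exists>P :: 'a set. d_polytope (2 * k + 1) P \<and> simplicial_polytope P \<and> neighborly P
           \<and> card (vertices P) = n
           \<and> (\<forall>M. missing_face P M \<longrightarrow> face_dim M = int k)"
  using kn
proof
  assume k: "odd k \<and> k \<ge> 3 \<and> n \<ge> 2 * k + 4"
  then have "moment_config k n (real n) (1/2) real_of_int" by (intro uniform_config) auto
  from moment_config.polytope_exists[OF this dim] show ?thesis
    using k uniform_no_long[of k n] by auto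
next
  assume k: "k = 2 \<and> n \<ge> 9"
  then interpret cluster n by unfold_locales simp
  have "DIM('a) = 2 * 2 + 1" using dim k by simp
  from moment_config.polytope_exists[OF cluster_config this] show ?thesis
    using k cluster_no_long by auto
qed

end
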